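(* Let $M$ be an $m$-dimensional pseudo-umbilical submanifold of the unit Euclidean sphere $\mathbb{S}^n$, with $m\neq4$. If $M$ is biharmonic, then it has constant mean curvature.
   Context: Manifolds are connected and smooth. For a smooth map $\phi:(M,g)\to(N,h)$ between Riemannian manifolds, the tension field is $\tau(\phi)=\operatorname{trace}\nabla d\phi$ and the bitension field is $\tau_2(\phi)=-\Delta\tau(\phi)-\operatorname{trace}R^N(d\phi,\tau(\phi))d\phi$, where $\Delta=-\operatorname{trace}\nabla^2$ is the rough Laplacian on sections of $\phi^{-1}TN$ and $R^N(X,Y)=[\nabla_X,\nabla_Y]-\nabla_{[X,Y]}$. The map $\phi$ is biharmonic if $\tau_2(\phi)=0$. A submanifold $M$ of $N$ (with induced metric) is called biharmonic if its inclusion map is biharmonic. The mean curvature vector field of $M^m$ is $H=\frac1m\operatorname{trace}B$, with $B$ the second fundamental form. $M$ has constant mean curvature if the norm $|H|$ is constant. A submanifold $M$ of a Riemannian manifold $N$ is pseudo-umbilical if there is a function $\lambda\in C^\infty(M)$ such that $A_H=\lambda\operatorname{Id}$, where $A_H$ is the Weingarten (shape) operator associated to $H$. *)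

theory Defs
  imports "HOL-Analysis.Analysis"
begin

section \<open>Smooth maps, manifolds and submanifolds\<close>

text \<open>\<open>D f x v\<close> is the derivative of \<open>f\<close> at \<open>x\<close> in the direction \<open>v\<close>.\<close>

abbreviation D :: "('a::real_normed_vector \<Rightarrow> 'b::real_normed_vector) \<Rightarrow> 'a \<Rightarrow> 'a \<Rightarrow> 'b"
  where "D f x v \<equiv> frechet_derivative f (at x) v"

text \<open>Only used for open \<open>S\<close> in a finite-dimensional space, where this is the class \<open>C\<^sup>k\<close>.\<close>

primrec Ck_on :: "nat \<Rightarrow> 'a::euclidean_space set \<Rightarrow> ('a \<Rightarrow> 'b::real_normed_vector) \<Rightarrow> bool" where
  "Ck_on 0 S f \<longleftrightarrow> continuous_on S f"
| "Ck_on (Suc k) S f \<longleftrightarrow>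
     (\<forall>x\<in>S. f differentiable (at x)) \<and> (\<forall>v. Ck_on k S (\<lambda>x. D f x v))"

definition smooth_on :: "'a::euclidean_space set \<Rightarrow> ('a \<Rightarrow> 'b::real_normed_vector) \<Rightarrow> bool"
  where "smooth_on S f \<longleftrightarrow> (\<forall>k. Ck_on k S f)"

text \<open>A chart \<open>(U, c)\<close> maps its domain \<open>U\<close> bijectively onto an open set of the model space; its
  inverse is \<open>inv_into U c\<close>. The dimension of the manifold is \<open>DIM('m)\<close>, hence at least 1.\<close>

type_synonym ('p, 'm) chart = "'p set \<times> ('p \<Rightarrow> 'm)"

definition connected_manifold :: "'p topology \<Rightarrow> ('p, 'm::euclidean_space) chart set \<Rightarrow> bool" where
  "connected_manifold X A \<longleftrightarrow>
     Hausdorff_space X \<and> second_countable X \<and> connected_space X \<and>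
     (\<Union>(U, c)\<in>A. U) = topspace X \<and>
     (\<forall>(U, c)\<in>A. openin X U \<and> open (c ` U) \<and>
        homeomorphic_map (subtopology X U) (top_of_set (c ` U)) c) \<and>
     (\<forall>(U, c)\<in>A. \<forall>(V, d)\<in>A. smooth_on (c ` (U \<inter> V)) (d \<circ> inv_into U c))"

definition smooth_function :: "('p, 'm::euclidean_space) chart set \<Rightarrow> ('p \<Rightarrow> real) \<Rightarrow> bool" where
  "smooth_function A f \<longleftrightarrow> (\<forall>(U, c)\<in>A. smooth_on (c ` U) (f \<circ> inv_into U c))"

text \<open>The standard (maximal) smooth atlas of an embedded submanifold \<open>N\<close> of a Euclidean space:
  all diffeomorphisms \<open>d\<close> from relatively open subsets \<open>V\<close> of \<open>N\<close> onto open subsets of the model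
  space, where smoothness of \<open>d\<close> on \<open>V\<close> means that \<open>d\<close> has a smooth extension to an open
  subset of the ambient space.\<close>

definition standard_charts ::
    "'a::euclidean_space set \<Rightarrow> ('a, 'n::euclidean_space) chart set" where
  "standard_charts N = {(V, d).
     openin (top_of_set N) V \<and> open (d ` V) \<and> inj_on d V \<and>
     smooth_on (d ` V) (inv_into V d) \<and>
     (\<exists>W G. open W \<and> V \<subseteq> W \<and> smooth_on W G \<and> (\<forall>q\<in>V. G q = d q))}"

text \<open>The submanifold is given by its inclusion \<open>\<phi>\<close>, which is allowed to be any immersion. For \<open>N\<close>
  embedded in Euclidean space, \<open>\<phi>\<close> is a smooth immersion into \<open>N\<close> iff it takes its values in \<open>N\<close>
  and is a smooth immersion into the ambient space.\<close>

definition immersed_submanifold ::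
    "'p topology \<Rightarrow> ('p, 'm::euclidean_space) chart set \<Rightarrow> ('p \<Rightarrow> 'a::euclidean_space) \<Rightarrow>
     'a set \<Rightarrow> bool" where
  "immersed_submanifold X A \<phi> N \<longleftrightarrow>
     connected_manifold X A \<and> \<phi> ` topspace X \<subseteq> N \<and>
     (\<forall>(U, c)\<in>A. smooth_on (c ` U) (\<phi> \<circ> inv_into U c) \<and>
        (\<forall>x\<in>c ` U. inj (D (\<phi> \<circ> inv_into U c) x)))"


section \<open>Riemannian geometry in a chart\<close>

text \<open>A Riemannian metric on an open subset of \<open>'m\<close> is written as \<open>g x u v\<close>. The vector
  \<open>raise g x l\<close> is the one dual to the linear form \<open>l\<close> under the inner product \<open>g x\<close>.\<close>

type_synonym 'm metric = "'m \<Rightarrow> 'm \<Rightarrow> 'm \<Rightarrow> real"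

definition raise :: "'m::euclidean_space metric \<Rightarrow> 'm \<Rightarrow> ('m \<Rightarrow> real) \<Rightarrow> 'm" where
  "raise g x l = (THE w. \<forall>z. g x w z = l z)"

text \<open>\<open>raise g x (\<lambda>z. z \<bullet> i) \<bullet> j\<close> is the entry \<open>g\<^sup>i\<^sup>j\<close> of the inverse matrix of the metric.\<close>

definition metric_trace ::
    "'m::euclidean_space metric \<Rightarrow> 'm \<Rightarrow> ('m \<Rightarrow> 'm \<Rightarrow> 'b::real_vector) \<Rightarrow> 'b" where
  "metric_trace g x b =
     (\<Sum>i\<in>Basis. \<Sum>j\<in>Basis. (raise g x (\<lambda>z. z \<bullet> i) \<bullet> j) *\<^sub>R b i j)"

text \<open>The Christoffel symbols of the Levi-Civita connection: for constant vector fields \<open>u\<close>, \<open>v\<close>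
  on the chart domain, \<open>\<nabla>\<^sub>u v = christoffel g x u v\<close> at \<open>x\<close>, given by the Koszul formula.\<close>

definition christoffel :: "'m::euclidean_space metric \<Rightarrow> 'm \<Rightarrow> 'm \<Rightarrow> 'm \<Rightarrow> 'm" where
  "christoffel g x u v = raise g x (\<lambda>z.
     (D (\<lambda>y. g y v z) x u + D (\<lambda>y. g y u z) x v - D (\<lambda>y. g y u v) x z) / 2)"

definition nabla ::
    "'n::euclidean_space metric \<Rightarrow> ('n \<Rightarrow> 'n) \<Rightarrow> ('n \<Rightarrow> 'n) \<Rightarrow> 'n \<Rightarrow> 'n" where
  "nabla h X Z y = D Z y (X y) + christoffel h y (X y) (Z y)"

definition lie_bracket ::
    "('n::euclidean_space \<Rightarrow> 'n) \<Rightarrow> ('n \<Rightarrow> 'n) \<Rightarrow> 'n \<Rightarrow> 'n" where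
  "lie_bracket X Y y = D Y y (X y) - D X y (Y y)"

text \<open>The curvature operator \<open>R(u,v)w\<close> at \<open>y\<close>. It is tensorial, so the tangent vectors
  may be extended to vector fields arbitrarily; we use the constant extensions in the chart.\<close>

definition curvature_fields ::
    "'n::euclidean_space metric \<Rightarrow> ('n \<Rightarrow> 'n) \<Rightarrow> ('n \<Rightarrow> 'n) \<Rightarrow> ('n \<Rightarrow> 'n) \<Rightarrow> 'n \<Rightarrow> 'n" where
  "curvature_fields h X Y Z y =
     nabla h X (nabla h Y Z) y - nabla h Y (nabla h X Z) y - nabla h (lie_bracket X Y) Z y"

definition curvature :: "'n::euclidean_space metric \<Rightarrow> 'n \<Rightarrow> 'n \<Rightarrow> 'n \<Rightarrow> 'n \<Rightarrow> 'n" where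
  "curvature h y u v w = curvature_fields h (\<lambda>_. u) (\<lambda>_. v) (\<lambda>_. w) y"

text \<open>In the remainder of this section \<open>F\<close> is a map between open subsets of \<open>'m\<close> and \<open>'n\<close>, with
  metrics \<open>g\<close> on the source and \<open>h\<close> on the target. A section \<open>\<sigma>\<close> of the pullback of the tangent
  bundle of the target is a function from the source to \<open>'n\<close>; \<open>pullback_nabla\<close> is the pullback
  connection and \<open>second_nabla\<close> the second covariant derivative
  \<open>\<nabla>\<^sub>u\<nabla>\<^sub>v\<sigma> - \<nabla>\<^bsub>\<nabla>\<^sub>u v\<^esub>\<sigma>\<close> for constant \<open>u\<close>, \<open>v\<close>.\<close>

definition pullback_nabla ::
    "'n::euclidean_space metric \<Rightarrow> ('m::euclidean_space \<Rightarrow> 'n) \<Rightarrow> ('m \<Rightarrow> 'n) \<Rightarrow> 'm \<Rightarrow> 'm \<Rightarrow> 'n"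
  where
  "pullback_nabla h F \<sigma> x u = D \<sigma> x u + christoffel h (F x) (D F x u) (\<sigma> x)"

definition second_nabla ::
    "'m::euclidean_space metric \<Rightarrow> 'n::euclidean_space metric \<Rightarrow> ('m \<Rightarrow> 'n) \<Rightarrow> ('m \<Rightarrow> 'n) \<Rightarrow>
     'm \<Rightarrow> 'm \<Rightarrow> 'm \<Rightarrow> 'n" where
  "second_nabla g h F \<sigma> x u v =
     pullback_nabla h F (\<lambda>y. pullback_nabla h F \<sigma> y v) x u
     - pullback_nabla h F \<sigma> x (christoffel g x u v)"

definition rough_laplacian ::
    "'m::euclidean_space metric \<Rightarrow> 'n::euclidean_space metric \<Rightarrow> ('m \<Rightarrow> 'n) \<Rightarrow> ('m \<Rightarrow> 'n) \<Rightarrow>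
     'm \<Rightarrow> 'n" where
  "rough_laplacian g h F \<sigma> x = - metric_trace g x (second_nabla g h F \<sigma> x)"

text \<open>\<open>nabla_d g h F x u v\<close> is \<open>(\<nabla>dF)(u, v)\<close> at \<open>x\<close>. For an isometric immersion \<open>F\<close> it is the second
  fundamental form \<open>B(u, v) = \<nabla>\<^sup>N\<^sub>u dF(v) - dF(\<nabla>\<^sup>M\<^sub>u v)\<close>.\<close>

definition nabla_d ::
    "'m::euclidean_space metric \<Rightarrow> 'n::euclidean_space metric \<Rightarrow> ('m \<Rightarrow> 'n) \<Rightarrow>
     'm \<Rightarrow> 'm \<Rightarrow> 'm \<Rightarrow> 'n" where
  "nabla_d g h F x u v =
     pullback_nabla h F (\<lambda>y. D F y v) x u - D F x (christoffel g x u v)"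

definition tension ::
    "'m::euclidean_space metric \<Rightarrow> 'n::euclidean_space metric \<Rightarrow> ('m \<Rightarrow> 'n) \<Rightarrow> 'm \<Rightarrow> 'n" where
  "tension g h F x = metric_trace g x (nabla_d g h F x)"

definition bitension ::
    "'m::euclidean_space metric \<Rightarrow> 'n::euclidean_space metric \<Rightarrow> ('m \<Rightarrow> 'n) \<Rightarrow> 'm \<Rightarrow> 'n" where
  "bitension g h F x =
     - rough_laplacian g h F (tension g h F) x
     - metric_trace g x (\<lambda>u v. curvature h (F x) (D F x u) (tension g h F x) (D F x v))"

definition mean_curvature ::
    "'m::euclidean_space metric \<Rightarrow> 'n::euclidean_space metric \<Rightarrow> ('m \<Rightarrow> 'n) \<Rightarrow> 'm \<Rightarrow> 'n" where
  "mean_curvature g h F x = (1 / real DIM('m)) *\<^sub>R metric_trace g x (nabla_d g h F x)"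

text \<open>The shape operator \<open>A\<^sub>\<eta>\<close> at \<open>x\<close>, characterized by \<open>g(A\<^sub>\<eta> u, v) = h(B(u, v), \<eta>)\<close>.\<close>

definition shape_operator ::
    "'m::euclidean_space metric \<Rightarrow> 'n::euclidean_space metric \<Rightarrow> ('m \<Rightarrow> 'n) \<Rightarrow> 'm \<Rightarrow> 'n \<Rightarrow>
     'm \<Rightarrow> 'm" where
  "shape_operator g h F x \<eta> u = raise g x (\<lambda>v. h (F x) (nabla_d g h F x u v) \<eta>)"


section \<open>Maps between Riemannian manifolds\<close>

text \<open>The metric, in a given chart, induced by an immersion \<open>\<phi>\<close> into a Euclidean space. With \<open>\<phi>\<close> the
  identity this is the induced metric of an embedded submanifold of the Euclidean space. If \<open>\<phi>\<close>
  takes its values in such a submanifold \<open>N\<close>, the metrics induced from \<open>N\<close> and from the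
  ambient space coincide.\<close>

definition induced_metric ::
    "('p \<Rightarrow> 'a::euclidean_space) \<Rightarrow> ('p, 'm::euclidean_space) chart \<Rightarrow> 'm metric" where
  "induced_metric \<phi> = (\<lambda>(U, c) x u v.
     D (\<phi> \<circ> inv_into U c) x u \<bullet> D (\<phi> \<circ> inv_into U c) x v)"

text \<open>A Riemannian metric on a manifold with atlas \<open>A\<close> is given by its expression in
  each chart. The notions below do not depend on the choice of charts at a point; we require them
  in all charts \<open>(U, c)\<close> at \<open>p\<close> and \<open>(V, d)\<close> at \<open>\<phi> p\<close>, where \<open>\<phi>\<close> has the expression
  \<open>d \<circ> \<phi> \<circ> inv_into U c\<close>, defined on \<open>c ` (U \<inter> \<phi> -` V)\<close>.\<close>

definition biharmonic ::
    "('p, 'm::euclidean_space) chart set \<Rightarrow> (('p, 'm) chart \<Rightarrow> 'm metric) \<Rightarrow>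
     ('q, 'n::euclidean_space) chart set \<Rightarrow> (('q, 'n) chart \<Rightarrow> 'n metric) \<Rightarrow>
     ('p \<Rightarrow> 'q) \<Rightarrow> bool" where
  "biharmonic A g B h \<phi> \<longleftrightarrow>
     (\<forall>(U, c)\<in>A. \<forall>(V, d)\<in>B. \<forall>p\<in>U \<inter> \<phi> -` V.
        bitension (g (U, c)) (h (V, d)) (d \<circ> \<phi> \<circ> inv_into U c) (c p) = 0)"

definition pseudo_umbilical ::
    "('p, 'm::euclidean_space) chart set \<Rightarrow> (('p, 'm) chart \<Rightarrow> 'm metric) \<Rightarrow>
     ('q, 'n::euclidean_space) chart set \<Rightarrow> (('q, 'n) chart \<Rightarrow> 'n metric) \<Rightarrow>
     ('p \<Rightarrow> 'q) \<Rightarrow> bool" where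
  "pseudo_umbilical A g B h \<phi> \<longleftrightarrow>
     (\<exists>\<mu>. smooth_function A \<mu> \<and>
       (\<forall>(U, c)\<in>A. \<forall>(V, d)\<in>B. \<forall>p\<in>U \<inter> \<phi> -` V.
          let F = d \<circ> \<phi> \<circ> inv_into U c;
              H = mean_curvature (g (U, c)) (h (V, d)) F (c p)
          in \<forall>u. shape_operator (g (U, c)) (h (V, d)) F (c p) H u = \<mu> p *\<^sub>R u))"

definition constant_mean_curvature ::
    "('p, 'm::euclidean_space) chart set \<Rightarrow> (('p, 'm) chart \<Rightarrow> 'm metric) \<Rightarrow>
     ('q, 'n::euclidean_space) chart set \<Rightarrow> (('q, 'n) chart \<Rightarrow> 'n metric) \<Rightarrow>
     ('p \<Rightarrow> 'q) \<Rightarrow> bool" where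
  "constant_mean_curvature A g B h \<phi> \<longleftrightarrow>
     (\<exists>k. \<forall>(U, c)\<in>A. \<forall>(V, d)\<in>B. \<forall>p\<in>U \<inter> \<phi> -` V.
        let F = d \<circ> \<phi> \<circ> inv_into U c;
            H = mean_curvature (g (U, c)) (h (V, d)) F (c p)
        in sqrt (h (V, d) (F (c p)) H H) = k)"

end

theory Submission
  imports Defs
begin

text \<open>
  The sphere sits in a Euclidean space \<open>E\<close>, and all the intrinsic objects translate into
  derivatives of \<open>E\<close>-valued functions on an open set of coordinates. Write \<open>\<Phi>\<close> for the immersion in a
  chart, \<open>B\<close> for its second fundamental form in the sphere, \<open>t = trace B = m H\<close> for the tension field
  as a vector of \<open>E\<close>, and \<open>\<rho> = |t|\<^sup>2 / m\<close>. The Christoffel symbols of an immersion are the tangential part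
  of its second derivative, and the pulled-back connection of the sphere is the derivative in \<open>E\<close>
  followed by the projection orthogonal to \<open>\<Phi>\<close> (\<open>pullback_nabla_ambient\<close>).

  Being pseudo-umbilical means \<open>B(u,v) \<bullet> t = \<rho> g(u,v)\<close>: the multiplier is determined by taking the
  trace. Since \<open>t\<close> is normal, \<open>D\<^sub>vt \<bullet> D\<^sub>u\<Phi> = - \<rho> g(u,v)\<close>. Two traces are now taken.

  \<^item> Differentiating the last identity gives the tangential part of the rough Laplacian of \<open>t\<close>.
    The curvature term of the bitension field is a multiple of \<open>t\<close>, so the tangential part of
    biharmonicity reads \<open>trace (D\<^sub>vt \<bullet> B(u,w)) = - D\<^sub>w\<rho>\<close>.
  \<^item> Differentiating \<open>D\<^sup>2\<Phi>(u,w) \<bullet> t = \<rho> g(u,w)\<close> and using the symmetry of third derivatives gives a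
    Codazzi equation, whose trace is \<open>trace (D\<^sub>vt \<bullet> B(u,w)) = (1 - m/2) D\<^sub>w\<rho>\<close>.

  Hence \<open>(2 - m/2) D\<^sub>w\<rho> = 0\<close>, and \<open>D\<rho> = 0\<close> if \<open>m \<noteq> 4\<close> (\<open>D_multiplier_eq_0\<close>).

  The passage from charts to the manifold is easy because the multiplier in the definition of
  a pseudo-umbilical submanifold is a function on \<open>M\<close> and equals \<open>|H|\<^sup>2\<close> in every chart. So the
  invariance of \<open>H\<close> under coordinate changes never has to be established: the multiplier is locally
  constant, hence constant by connectedness. For this, each point of the sphere must lie in some chart
  (\<open>standard_charts_cover_sphere\<close>).

  The tension field contains the inverse matrix of the metric and is differentiated twice, so a
  preliminary part proves that the inverse matrix is smooth.
\<close>

section \<open>Calculus of smooth functions\<close>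

lemma D_eq: "(f has_derivative f') (at x) \<Longrightarrow> D f x v = f' v"
  using frechet_derivative_at by metis

lemma D_has_derivative: "f differentiable (at x) \<Longrightarrow> (f has_derivative (\<lambda>v. D f x v)) (at x)"
  by (simp add: frechet_derivative_works)

lemma D_cong_open:
  assumes "open S" "x \<in> S" "\<And>y. y \<in> S \<Longrightarrow> f y = g y"
  shows "D f x v = D g x v"
proof -
  have "(f has_derivative f') (at x) = (g has_derivative f') (at x)" for f'
    using has_derivative_transform_within_open[OF _ assms(1,2), of f f' UNIV g]
      has_derivative_transform_within_open[OF _ assms(1,2), of g f' UNIV f] assms(3) by auto
  then show ?thesis
    unfolding frechet_derivative_def by simp
qed

lemma differentiable_cong_open:
  assumes "open S" "x \<in> S" "\<And>y. y \<in> S \<Longrightarrow> f y = g y" "f differentiable (at x)"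
  shows "g differentiable (at x)"
  using assms has_derivative_transform_within_open[OF _ assms(1,2)] 
  by (meson differentiable_def)

lemma linear_D: "f differentiable (at x) \<Longrightarrow> linear (D f x)"
  by (rule linear_frechet_derivative)

lemma linear_expand_Basis:
  fixes L :: "'a::euclidean_space \<Rightarrow> 'b::real_vector"
  assumes "linear L"
  shows "L v = (\<Sum>b\<in>Basis. (v \<bullet> b) *\<^sub>R L b)"
proof -
  have "L v = L (\<Sum>b\<in>Basis. (v \<bullet> b) *\<^sub>R b)" by (simp add: euclidean_representation)
  also have "\<dots> = (\<Sum>b\<in>Basis. (v \<bullet> b) *\<^sub>R L b)"
    by (simp add: linear_sum[OF assms] linear_scale[OF assms])
  finally show ?thesis .
qed

lemma Ck_on_cong:
  assumes "open S"
  shows "\<lbrakk>\<And>x. x \<in> S \<Longrightarrow> f x = g x; Ck_on k S f\<rbrakk> \<Longrightarrow> Ck_on k S g"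
proof (induction k arbitrary: f g)
  case 0
  then show ?case using continuous_on_cong by (metis Ck_on.simps(1))
next
  case (Suc k)
  show ?case
  proof (simp only: Ck_on.simps, intro conjI ballI allI)
    fix x assume "x \<in> S"
    then show "g differentiable (at x)"
      using differentiable_cong_open[OF assms _ Suc.prems(1)] Suc.prems(2) by auto
  next
    fix v
    have "D f x v = D g x v" if "x \<in> S" for x
      using D_cong_open[OF assms that Suc.prems(1)] by auto
    then show "Ck_on k S (\<lambda>x. D g x v)"
      using Suc.IH[of "\<lambda>x. D f x v"] Suc.prems(2) by auto
  qed
qed

lemma Ck_on_imp_continuous_on: "Ck_on k S f \<Longrightarrow> continuous_on S f"
  by (cases k) (auto intro!: continuous_at_imp_continuous_on differentiable_imp_continuous_within)

lemma Ck_on_Suc_imp: "Ck_on (Suc k) S f \<Longrightarrow> Ck_on k S f"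
proof (induction k arbitrary: f)
  case 0
  then show ?case using Ck_on_imp_continuous_on by (metis Ck_on.simps(1))
next
  case (Suc k)
  then show ?case by (metis Ck_on.simps(2))
qed

lemma Ck_on_const: "Ck_on k S (\<lambda>x. c)"
  by (induction k arbitrary: c) auto

lemma Ck_on_bounded_linear:
  fixes f :: "'a::euclidean_space \<Rightarrow> 'b::real_normed_vector"
  assumes L: "bounded_linear L" and S: "open S"
  shows "Ck_on k S f \<Longrightarrow> Ck_on k S (\<lambda>x. L (f x))"
proof (induction k arbitrary: f)
  case 0
  then show ?case using bounded_linear.continuous_on[OF L] by simp
next
  case (Suc k)
  have d: "((\<lambda>x. L (f x)) has_derivative (\<lambda>v. L (D f x v))) (at x)" if "x \<in> S" for x
    using bounded_linear.has_derivative[OF L D_has_derivative] Suc.prems that by auto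
  have "Ck_on k S (\<lambda>x. D (\<lambda>x. L (f x)) x v)" for v
    by (rule Ck_on_cong[OF S, of "\<lambda>x. L (D f x v)"]) (use D_eq[OF d] Suc in auto)
  with d show ?case by (auto simp: differentiable_def)
qed

lemma Ck_on_add:
  assumes S: "open S"
  shows "Ck_on k S f \<Longrightarrow> Ck_on k S g \<Longrightarrow> Ck_on k S (\<lambda>x. f x + g x)"
proof (induction k arbitrary: f g)
  case 0
  then show ?case by (auto intro: continuous_on_add)
next
  case (Suc k)
  have d: "((\<lambda>x. f x + g x) has_derivative (\<lambda>v. D f x v + D g x v)) (at x)" if "x \<in> S" for x
    using has_derivative_add[OF D_has_derivative[of f x] D_has_derivative[of g x]] Suc.prems that
    by auto
  have "Ck_on k S (\<lambda>x. D (\<lambda>x. f x + g x) x v)" for v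
    by (rule Ck_on_cong[OF S, of "\<lambda>x. D f x v + D g x v"]) (use D_eq[OF d] Suc in auto)
  with d show ?case by (auto simp: differentiable_def)
qed

lemma Ck_on_sum:
  assumes S: "open S" and "\<And>i. i \<in> I \<Longrightarrow> Ck_on k S (f i)"
  shows "Ck_on k S (\<lambda>x. \<Sum>i\<in>I. f i x)"
  using assms(2)
  by (induction I rule: infinite_finite_induct) (auto intro!: Ck_on_const Ck_on_add[OF S])

lemma Ck_on_bilinear:
  assumes B: "bounded_bilinear B" and S: "open S"
  shows "Ck_on k S f \<Longrightarrow> Ck_on k S g \<Longrightarrow> Ck_on k S (\<lambda>x. B (f x) (g x))"
proof (induction k arbitrary: f g)
  case 0
  then show ?case using bounded_bilinear.continuous_on[OF B] by auto
next
  case (Suc k)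
  have d: "((\<lambda>x. B (f x) (g x)) has_derivative (\<lambda>v. B (f x) (D g x v) + B (D f x v) (g x))) (at x)"
    if "x \<in> S" for x
    using bounded_bilinear.FDERIV[OF B D_has_derivative[of f x] D_has_derivative[of g x]]
      Suc.prems that by auto
  have "Ck_on k S (\<lambda>x. D (\<lambda>x. B (f x) (g x)) x v)" for v
    by (rule Ck_on_cong[OF S, of "\<lambda>x. B (f x) (D g x v) + B (D f x v) (g x)"])
      (use D_eq[OF d] Suc Ck_on_Suc_imp[OF Suc.prems(1)] Ck_on_Suc_imp[OF Suc.prems(2)] in
        \<open>auto intro!: Ck_on_add[OF S]\<close>)
  with d show ?case by (auto simp: differentiable_def)
qed

lemma Ck_on_compose:
  fixes g :: "'a::euclidean_space \<Rightarrow> 'b::euclidean_space" and f :: "'b \<Rightarrow> 'c::real_normed_vector"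
  assumes S: "open S" and T: "\<And>x. x \<in> S \<Longrightarrow> g x \<in> T"
  shows "Ck_on k T f \<Longrightarrow> Ck_on k S g \<Longrightarrow> Ck_on k S (\<lambda>x. f (g x))"
proof (induction k arbitrary: f)
  case 0
  then show ?case using continuous_on_compose2[of T f S g] T by auto
next
  case (Suc k)
  have d: "((\<lambda>x. f (g x)) has_derivative (\<lambda>v. D f (g x) (D g x v))) (at x)" if "x \<in> S" for x
    using has_derivative_compose[OF D_has_derivative D_has_derivative, of g x f] Suc.prems that T
    by auto
  have e: "D (\<lambda>x. f (g x)) x v = (\<Sum>b\<in>Basis. (D g x v \<bullet> b) *\<^sub>R D f (g x) b)" if "x \<in> S" for x v
    unfolding D_eq[OF d[OF that]]
    by (rule linear_expand_Basis[OF linear_D]) (use Suc.prems T[OF that] in auto)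
  have g: "Ck_on k S g" using Suc.prems(2) by (rule Ck_on_Suc_imp)
  have f: "Ck_on k S (\<lambda>x. D f (g x) b)" for b
    using Suc.IH[of "\<lambda>y. D f y b"] Suc.prems(1) g by simp
  have "Ck_on k S (\<lambda>x. D (\<lambda>x. f (g x)) x v)" for v
    by (rule Ck_on_cong[OF S, of "\<lambda>x. \<Sum>b\<in>Basis. (D g x v \<bullet> b) *\<^sub>R D f (g x) b"])
      (use e Suc f in \<open>auto intro!: Ck_on_sum[OF S]
          Ck_on_bilinear[OF bounded_bilinear_scaleR S] Ck_on_bilinear[OF bounded_bilinear_inner S]
          Ck_on_const\<close>)
  with d show ?case by (auto simp: differentiable_def)
qed

lemma smooth_on_differentiable: "smooth_on S f \<Longrightarrow> x \<in> S \<Longrightarrow> f differentiable (at x)"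
  by (drule iffD1[OF smooth_on_def], drule spec[of _ "Suc 0"]) simp

lemma smooth_on_continuous_on: "smooth_on S f \<Longrightarrow> continuous_on S f"
  unfolding smooth_on_def using Ck_on_imp_continuous_on by blast

lemma smooth_on_has_derivative:
  "smooth_on S f \<Longrightarrow> x \<in> S \<Longrightarrow> (f has_derivative (\<lambda>v. D f x v)) (at x)"
  by (simp add: D_has_derivative smooth_on_differentiable)

lemma smooth_on_D:
  assumes "smooth_on S f"
  shows "smooth_on S (\<lambda>x. D f x v)"
  unfolding smooth_on_def
proof
  fix k
  have "Ck_on (Suc k) S f" using assms by (simp add: smooth_on_def)
  then show "Ck_on k S (\<lambda>x. D f x v)" by simp
qed

lemma smooth_on_cong:
  "open S \<Longrightarrow> smooth_on S f \<Longrightarrow> (\<And>x. x \<in> S \<Longrightarrow> f x = g x) \<Longrightarrow> smooth_on S g"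
  unfolding smooth_on_def by (auto intro: Ck_on_cong)

lemma smooth_on_subset:
  assumes "smooth_on S f" "T \<subseteq> S"
  shows "smooth_on T f"
proof -
  have "Ck_on k S f \<Longrightarrow> Ck_on k T f" for k
    by (induction k arbitrary: f) (use assms(2) in \<open>auto intro: continuous_on_subset\<close>)
  with assms(1) show ?thesis by (auto simp: smooth_on_def)
qed

lemma smooth_on_const: "smooth_on S (\<lambda>x. c)"
  by (simp add: smooth_on_def Ck_on_const)

lemma smooth_on_ident: "smooth_on S (\<lambda>x. x)"
proof -
  have "Ck_on k S (\<lambda>x. x)" for k
    by (cases k) (auto simp: Ck_on_const continuous_on_id)
  then show ?thesis by (simp add: smooth_on_def)
qed

lemma smooth_on_bounded_linear:
  "open S \<Longrightarrow> bounded_linear L \<Longrightarrow> smooth_on S f \<Longrightarrow> smooth_on S (\<lambda>x. L (f x))"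
  by (simp add: smooth_on_def Ck_on_bounded_linear)

lemma smooth_on_add:
  "open S \<Longrightarrow> smooth_on S f \<Longrightarrow> smooth_on S g \<Longrightarrow> smooth_on S (\<lambda>x. f x + g x)"
  by (simp add: smooth_on_def Ck_on_add)

lemma smooth_on_bilinear:
  "open S \<Longrightarrow> bounded_bilinear B \<Longrightarrow> smooth_on S f \<Longrightarrow> smooth_on S g \<Longrightarrow>
    smooth_on S (\<lambda>x. B (f x) (g x))"
  by (simp add: smooth_on_def Ck_on_bilinear)

lemma smooth_on_minus: "open S \<Longrightarrow> smooth_on S f \<Longrightarrow> smooth_on S (\<lambda>x. - f x)"
  by (rule smooth_on_bounded_linear[OF _ bounded_linear_minus[OF bounded_linear_ident]])

lemma smooth_on_diff:
  "open S \<Longrightarrow> smooth_on S f \<Longrightarrow> smooth_on S g \<Longrightarrow> smooth_on S (\<lambda>x. f x - g x)"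
  using smooth_on_add[of S f "\<lambda>x. - g x"] smooth_on_minus[of S g] by simp

lemmas smooth_on_scaleR = smooth_on_bilinear[OF _ bounded_bilinear_scaleR]
lemmas smooth_on_inner = smooth_on_bilinear[OF _ bounded_bilinear_inner]

lemma smooth_on_sum:
  "open S \<Longrightarrow> (\<And>i. i \<in> I \<Longrightarrow> smooth_on S (f i)) \<Longrightarrow> smooth_on S (\<lambda>x. \<Sum>i\<in>I. f i x)"
  by (simp add: smooth_on_def Ck_on_sum)

lemma smooth_on_compose:
  fixes g :: "'a::euclidean_space \<Rightarrow> 'b::euclidean_space" and f :: "'b \<Rightarrow> 'c::real_normed_vector"
  shows "open S \<Longrightarrow> (\<And>x. x \<in> S \<Longrightarrow> g x \<in> T) \<Longrightarrow> smooth_on T f \<Longrightarrow> smooth_on S g \<Longrightarrow>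
    smooth_on S (\<lambda>x. f (g x))"
  unfolding smooth_on_def using Ck_on_compose[of S g T] by blast

lemma smooth_on_D_field:
  fixes f :: "'a::euclidean_space \<Rightarrow> 'b::euclidean_space" and G :: "'b \<Rightarrow> 'c::real_normed_vector"
  assumes S: "open S" and T: "\<And>x. x \<in> S \<Longrightarrow> f x \<in> T"
    and G: "smooth_on T G" and f: "smooth_on S f" and s: "smooth_on S s"
  shows "smooth_on S (\<lambda>x. D G (f x) (s x))"
proof (rule smooth_on_cong[OF S])
  show "smooth_on S (\<lambda>x. \<Sum>b\<in>Basis. (s x \<bullet> b) *\<^sub>R D G (f x) b)"
    by (intro smooth_on_sum smooth_on_scaleR smooth_on_inner smooth_on_const S s
        smooth_on_compose[OF S T smooth_on_D[OF G] f])
  show "(\<Sum>b\<in>Basis. (s x \<bullet> b) *\<^sub>R D G (f x) b) = D G (f x) (s x)" if "x \<in> S" for x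
    by (rule linear_expand_Basis[OF linear_D[OF smooth_on_differentiable[OF G T[OF that]]], symmetric])
qed

lemma smooth_on_inverse:
  fixes f :: "'a::euclidean_space \<Rightarrow> real"
  assumes S: "open S" and f: "smooth_on S f" and nz: "\<And>x. x \<in> S \<Longrightarrow> f x \<noteq> 0"
  shows "smooth_on S (\<lambda>x. inverse (f x))"
proof -
  have d: "((\<lambda>x. inverse (f x)) has_derivative (\<lambda>v. - (inverse (f x) * D f x v * inverse (f x)))) (at x)"
    if "x \<in> S" for x
    using Deriv.has_derivative_inverse[OF nz[OF that] smooth_on_has_derivative[OF f that]] by simp
  have "Ck_on k S (\<lambda>x. inverse (f x))" for k
  proof (induction k)
    case 0
    then show ?case
      using smooth_on_continuous_on[OF f] nz by (auto intro!: continuous_on_inverse)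
  next
    case (Suc k)
    have "Ck_on k S (\<lambda>x. D f x v)" for v
      using smooth_on_D[OF f] by (auto simp: smooth_on_def)
    then have "Ck_on k S (\<lambda>x. - (inverse (f x) * D f x v * inverse (f x)))" for v
      by (intro Ck_on_bounded_linear[OF bounded_linear_minus[OF bounded_linear_ident] S]
          Ck_on_bilinear[OF bounded_bilinear_mult S] Suc)
    then have "Ck_on k S (\<lambda>x. D (\<lambda>x. inverse (f x)) x v)" for v
      using Ck_on_cong[OF S, of "\<lambda>x. - (inverse (f x) * D f x v * inverse (f x))"] D_eq[OF d]
      by simp
    with d show ?case by (auto simp: differentiable_def)
  qed
  then show ?thesis by (simp add: smooth_on_def)
qed

section \<open>Symmetry of second derivatives\<close>

abbreviation D2 :: "('a::real_normed_vector \<Rightarrow> 'b::real_normed_vector) \<Rightarrow> 'a \<Rightarrow> 'a \<Rightarrow> 'a \<Rightarrow> 'b"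
  where "D2 f x u v \<equiv> D (\<lambda>y. D f y v) x u"

lemma has_real_derivative_along_line:
  fixes f :: "'a::real_normed_vector \<Rightarrow> real"
  assumes "f differentiable (at (p + t *\<^sub>R u))"
  shows "((\<lambda>t. f (p + t *\<^sub>R u)) has_real_derivative D f (p + t *\<^sub>R u) u) (at t)"
proof -
  have l: "((\<lambda>t. p + t *\<^sub>R u) has_derivative (\<lambda>s. s *\<^sub>R u)) (at t)"
    by (auto intro!: derivative_eq_intros)
  have "((\<lambda>t. f (p + t *\<^sub>R u)) has_derivative (\<lambda>s. D f (p + t *\<^sub>R u) (s *\<^sub>R u))) (at t)"
    using has_derivative_compose[OF l D_has_derivative[OF assms]] .
  moreover have "D f (p + t *\<^sub>R u) (s *\<^sub>R u) = s *\<^sub>R D f (p + t *\<^sub>R u) u" for s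
    using linear_D[OF assms] by (simp add: linear_scale)
  ultimately show ?thesis by (simp add: has_field_derivative_def mult_commute_abs)
qed

text \<open>The second difference of \<open>f\<close> over a small parallelogram is, by the mean value theorem applied
  once in each direction, a value of the second derivative at a nearby point.\<close>

lemma second_difference_mean_value:
  fixes f :: "'a::euclidean_space \<Rightarrow> real"
  assumes f: "smooth_on S f" and s: "0 < s"
    and S: "\<And>a b. 0 \<le> a \<Longrightarrow> a \<le> s \<Longrightarrow> 0 \<le> b \<Longrightarrow> b \<le> s \<Longrightarrow> x + a *\<^sub>R u + b *\<^sub>R v \<in> S"
  shows "\<exists>a b. 0 \<le> a \<and> a \<le> s \<and> 0 \<le> b \<and> b \<le> s \<and>
    f (x + s *\<^sub>R u + s *\<^sub>R v) - f (x + s *\<^sub>R u) - f (x + s *\<^sub>R v) + f x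
      = s * s * D2 f (x + a *\<^sub>R u + b *\<^sub>R v) v u"
proof -
  let ?\<phi> = "\<lambda>t. f (x + s *\<^sub>R v + t *\<^sub>R u) - f (x + t *\<^sub>R u)"
  have "(?\<phi> has_real_derivative D f (x + s *\<^sub>R v + t *\<^sub>R u) u - D f (x + t *\<^sub>R u) u) (at t)"
    if "0 \<le> t" "t \<le> s" for t
    using that s S[of t s] S[of t 0]
    by (intro DERIV_diff has_real_derivative_along_line smooth_on_differentiable[OF f])
      (auto simp: algebra_simps)
  from MVT2[OF s this] obtain a where a: "0 < a" "a < s"
    "?\<phi> s - ?\<phi> 0 = s * (D f (x + s *\<^sub>R v + a *\<^sub>R u) u - D f (x + a *\<^sub>R u) u)"
    by auto
  have "((\<lambda>t. D f (x + a *\<^sub>R u + t *\<^sub>R v) u) has_real_derivative D2 f (x + a *\<^sub>R u + t *\<^sub>R v) v u) (at t)"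
    if "0 \<le> t" "t \<le> s" for t
    using that s S[of a t] a
    by (intro has_real_derivative_along_line smooth_on_differentiable[OF smooth_on_D[OF f]]) auto
  from MVT2[OF s this] obtain b where b: "0 < b" "b < s"
    "D f (x + a *\<^sub>R u + s *\<^sub>R v) u - D f (x + a *\<^sub>R u) u = s * D2 f (x + a *\<^sub>R u + b *\<^sub>R v) v u"
    by auto
  have "?\<phi> s - ?\<phi> 0 = s * (s * D2 f (x + a *\<^sub>R u + b *\<^sub>R v) v u)"
    unfolding a(3) b(3)[symmetric] by (simp add: algebra_simps)
  then show ?thesis
    using a b by (intro exI[of _ a] exI[of _ b]) (auto simp: algebra_simps)
qed

text \<open>The second difference is symmetric in the two directions, so values of the two mixed
  derivatives at points near \<open>x\<close> coincide; continuity does the rest.\<close>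

lemma D2_symmetric_real:
  fixes f :: "'a::euclidean_space \<Rightarrow> real"
  assumes S: "open S" and f: "smooth_on S f" and x: "x \<in> S"
  shows "D2 f x u v = D2 f x v u"
proof (rule ccontr)
  assume ne: "D2 f x u v \<noteq> D2 f x v u"
  define e where "e = \<bar>D2 f x u v - D2 f x v u\<bar> / 2"
  have e: "e > 0" using ne by (simp add: e_def)
  have cont: "isCont (\<lambda>y. D2 f y a b) x" for a b
    using smooth_on_continuous_on[OF smooth_on_D[OF smooth_on_D[OF f]]] S x
    by (simp add: continuous_on_eq_continuous_at)
  obtain d1 where d1: "d1 > 0" "\<And>y. dist y x < d1 \<Longrightarrow> \<bar>D2 f y u v - D2 f x u v\<bar> < e"
    using cont[where a = u and b = v, unfolded continuous_at_eps_delta, rule_format, OF e]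
    by (auto simp: dist_real_def)
  obtain d2 where d2: "d2 > 0" "\<And>y. dist y x < d2 \<Longrightarrow> \<bar>D2 f y v u - D2 f x v u\<bar> < e"
    using cont[where a = v and b = u, unfolded continuous_at_eps_delta, rule_format, OF e]
    by (auto simp: dist_real_def)
  obtain d3 where d3: "d3 > 0" "\<And>y. dist y x < d3 \<Longrightarrow> y \<in> S"
    using S x unfolding open_dist by blast
  define d where "d = min d1 (min d2 d3)"
  have d: "d > 0" using d1 d2 d3 by (simp add: d_def)
  define s where "s = d / (norm u + norm v + 1)"
  have nn: "norm u + norm v + 1 > 0" by (simp add: add_nonneg_pos)
  have s: "s > 0" using d nn by (simp add: s_def)
  have near: "dist (x + a *\<^sub>R u + b *\<^sub>R v) x < d" if "0 \<le> a" "a \<le> s" "0 \<le> b" "b \<le> s" for a b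
  proof -
    have "dist (x + a *\<^sub>R u + b *\<^sub>R v) x \<le> a * norm u + b * norm v"
      using norm_triangle_ineq[of "a *\<^sub>R u" "b *\<^sub>R v"] that by (simp add: dist_norm add.assoc)
    also have "\<dots> \<le> s * norm u + s * norm v"
      using that by (intro add_mono mult_right_mono) auto
    also have "\<dots> < s * (norm u + norm v + 1)" using s by (simp add: algebra_simps)
    also have "\<dots> = d" using nn by (simp add: s_def)
    finally show ?thesis .
  qed
  have inS: "x + a *\<^sub>R u + b *\<^sub>R v \<in> S" if "0 \<le> a" "a \<le> s" "0 \<le> b" "b \<le> s" for a b
    using d3(2) near[OF that] by (simp add: d_def)
  obtain a b where ab: "0 \<le> a" "a \<le> s" "0 \<le> b" "b \<le> s"
    "f (x + s *\<^sub>R u + s *\<^sub>R v) - f (x + s *\<^sub>R u) - f (x + s *\<^sub>R v) + f x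
      = s * s * D2 f (x + a *\<^sub>R u + b *\<^sub>R v) v u"
    using second_difference_mean_value[OF f s inS] by blast
  obtain a' b' where ab': "0 \<le> a'" "a' \<le> s" "0 \<le> b'" "b' \<le> s"
    "f (x + s *\<^sub>R v + s *\<^sub>R u) - f (x + s *\<^sub>R v) - f (x + s *\<^sub>R u) + f x
      = s * s * D2 f (x + a' *\<^sub>R v + b' *\<^sub>R u) u v"
  proof -
    have "x + a *\<^sub>R v + b *\<^sub>R u \<in> S" if "0 \<le> a" "a \<le> s" "0 \<le> b" "b \<le> s" for a b
      using inS[OF that(3,4,1,2)] by (simp add: algebra_simps)
    from second_difference_mean_value[OF f s this] show ?thesis using that by blast
  qed
  have "f (x + s *\<^sub>R u + s *\<^sub>R v) - f (x + s *\<^sub>R u) - f (x + s *\<^sub>R v) + f x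
      = f (x + s *\<^sub>R v + s *\<^sub>R u) - f (x + s *\<^sub>R v) - f (x + s *\<^sub>R u) + f x"
    by (simp add: add.assoc add.commute[of "s *\<^sub>R u"])
  then have "s * s * D2 f (x + a *\<^sub>R u + b *\<^sub>R v) v u = s * s * D2 f (x + b' *\<^sub>R u + a' *\<^sub>R v) u v"
    unfolding ab(5) ab'(5) by (simp add: add.assoc add.commute[of "b' *\<^sub>R u"])
  then have "D2 f (x + a *\<^sub>R u + b *\<^sub>R v) v u = D2 f (x + b' *\<^sub>R u + a' *\<^sub>R v) u v"
    using s by simp
  moreover have "\<bar>D2 f (x + a *\<^sub>R u + b *\<^sub>R v) v u - D2 f x v u\<bar> < e"
    using d2(2) near[OF ab(1-4)] by (simp add: d_def)
  moreover have "\<bar>D2 f (x + b' *\<^sub>R u + a' *\<^sub>R v) u v - D2 f x u v\<bar> < e"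
    using d1(2) near[OF ab'(3,4,1,2)] by (simp add: d_def)
  moreover have False
    if "p = q" "\<bar>p - r\<bar> < \<bar>t - r\<bar> / 2" "\<bar>q - t\<bar> < \<bar>t - r\<bar> / 2" for p q r t :: real
    using that by (auto simp: abs_if split: if_splits)
  ultimately show False unfolding e_def by blast
qed

lemma D_inner_const:
  assumes "f differentiable (at x)"
  shows "D (\<lambda>y. f y \<bullet> b) x v = D f x v \<bullet> b"
  by (rule D_eq) (rule has_derivative_inner_left[OF D_has_derivative[OF assms]])

lemma D2_symmetric:
  fixes f :: "'a::euclidean_space \<Rightarrow> 'b::euclidean_space"
  assumes S: "open S" and f: "smooth_on S f" and x: "x \<in> S"
  shows "D2 f x u v = D2 f x v u"
proof (rule euclidean_eqI)
  fix b :: 'b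
  have fb: "smooth_on S (\<lambda>y. f y \<bullet> b)"
    by (intro smooth_on_inner S f smooth_on_const)
  have "D2 (\<lambda>y. f y \<bullet> b) x u v = D2 f x u v \<bullet> b" for u v
  proof -
    have "D2 (\<lambda>y. f y \<bullet> b) x u v = D (\<lambda>y. D f y v \<bullet> b) x u"
      by (rule D_cong_open[OF S x]) (simp add: D_inner_const smooth_on_differentiable[OF f])
    also have "\<dots> = D2 f x u v \<bullet> b"
      by (simp add: D_inner_const smooth_on_differentiable[OF smooth_on_D[OF f] x])
    finally show ?thesis .
  qed
  then show "D2 f x u v \<bullet> b = D2 f x v u \<bullet> b"
    using D2_symmetric_real[OF S fb x, of u v] by simp
qed

lemma linear_D2_left:
  assumes "smooth_on S f" "x \<in> S"
  shows "linear (\<lambda>u. D2 f x u v)"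
  using linear_D[OF smooth_on_differentiable[OF smooth_on_D[OF assms(1)] assms(2)]] .

lemma linear_D2_right:
  fixes f :: "'a::euclidean_space \<Rightarrow> 'b::euclidean_space"
  assumes "open S" "smooth_on S f" "x \<in> S"
  shows "linear (D2 f x u)"
proof -
  have "D2 f x u = (\<lambda>v. D2 f x v u)" using D2_symmetric[OF assms] by blast
  then show ?thesis using linear_D2_left[OF assms(2,3), of u] by metis
qed

section \<open>Metrics given by an injective linear map\<close>

text \<open>\<open>dual g x i \<bullet> j\<close> is the entry \<open>g\<^sup>i\<^sup>j\<close> of the inverse matrix of the metric.\<close>

abbreviation dual :: "'m::euclidean_space metric \<Rightarrow> 'm \<Rightarrow> 'm \<Rightarrow> 'm" where
  "dual g x i \<equiv> raise g x (\<lambda>z. z \<bullet> i)"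

text \<open>All metrics below are induced by immersions, so at a point they are pulled back from a
  Euclidean inner product by an injective linear map. Stating the algebra of \<open>raise\<close> and
  \<open>metric_trace\<close> for such metrics avoids a separate notion of positive definite form.\<close>

locale injective_linear =
  fixes L :: "'m::euclidean_space \<Rightarrow> 'a::euclidean_space" and g :: "'m metric" and x :: 'm
  assumes linear: "linear L" and inj: "inj L" and g: "g x u v = L u \<bullet> L v"
begin

lemma metric_cancel:
  assumes "\<And>z. L v \<bullet> L z = L w \<bullet> L z"
  shows "v = w"
proof -
  have "L (v - w) \<bullet> L (v - w) = 0"
    using assms[of "v - w"] by (simp add: linear_diff[OF linear] inner_diff_left)
  then have "L v = L w" by (simp add: linear_diff[OF linear])
  then show ?thesis using inj by (simp add: inj_eq)
qed

lemma raise_eqI: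
  assumes "\<And>z. L w \<bullet> L z = l z"
  shows "raise g x l = w"
  unfolding raise_def g using assms metric_cancel by (intro the_equality) auto

text \<open>Existence of the vector dual to a linear form: the endomorphism taking \<open>w\<close> to the Euclidean
  representative of \<open>g(w, \<cdot>)\<close> is injective by definiteness, hence surjective.\<close>

lemma metric_raise:
  assumes l: "linear l"
  shows "L (raise g x l) \<bullet> L z = l z"
proof -
  let ?T = "\<lambda>w. \<Sum>j\<in>Basis. (L w \<bullet> L j) *\<^sub>R j"
  have exp: "L w \<bullet> L z = ?T w \<bullet> z" for w z
  proof -
    have "L w \<bullet> L z = (\<Sum>j\<in>Basis. (L w \<bullet> L j) * (z \<bullet> j))"
      by (subst linear_expand_Basis[OF linear, of z])
        (simp add: inner_sum_right mult.commute inner_commute[of z])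
    then show ?thesis by (simp add: inner_sum_left inner_commute[of z])
  qed
  have "linear ?T"
    by (auto intro!: linearI simp: linear_add[OF linear] linear_scale[OF linear]
        inner_add_left scaleR_left_distrib sum.distrib scaleR_sum_right)
  moreover have "inj ?T"
  proof (rule injI)
    fix v w assume "?T v = ?T w"
    then have "L v \<bullet> L z = L w \<bullet> L z" for z
      using exp[of v z] exp[of w z] by presburger
    then show "v = w" by (rule metric_cancel)
  qed
  ultimately have "surj ?T" by (rule linear_injective_imp_surjective) simp
  from surjD[OF this, of "\<Sum>j\<in>Basis. l j *\<^sub>R j"]
  obtain w where w: "?T w = (\<Sum>j\<in>Basis. l j *\<^sub>R j)" by force
  have "L w \<bullet> L z = l z" for z
    unfolding exp[of w z] w using linear_expand_Basis[OF l, of z]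
    by (simp add: inner_sum_left inner_commute[of z] mult.commute)
  with raise_eqI[OF this] show ?thesis by simp
qed

lemma metric_dual: "L (dual g x i) \<bullet> L z = z \<bullet> i"
  by (rule metric_raise) (simp add: bounded_linear.linear bounded_linear_inner_left)

lemma dual_symmetric: "dual g x i \<bullet> j = dual g x j \<bullet> i"
  using metric_dual[of j "dual g x i"] metric_dual[of i "dual g x j"] inner_commute[of "L (dual g x i)"]
  by simp

lemma raise_expand:
  assumes l: "linear l"
  shows "raise g x l = (\<Sum>j\<in>Basis. l j *\<^sub>R dual g x j)"
proof (rule raise_eqI)
  fix z
  show "L (\<Sum>j\<in>Basis. l j *\<^sub>R dual g x j) \<bullet> L z = l z"
    using linear_expand_Basis[OF l, of z]
    by (simp add: linear_sum[OF linear] linear_scale[OF linear] inner_sum_left metric_dual mult.commute)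
qed

lemma expand_dual: "w = (\<Sum>j\<in>Basis. (L w \<bullet> L j) *\<^sub>R dual g x j)"
proof -
  have "raise g x (\<lambda>z. L w \<bullet> L z) = w" by (rule raise_eqI) simp
  moreover have "linear (\<lambda>z. L w \<bullet> L z)"
    by (auto intro!: linearI simp: linear_add[OF linear] linear_scale[OF linear] inner_add_right)
  ultimately show ?thesis using raise_expand[of "\<lambda>z. L w \<bullet> L z"] by argo
qed

lemma metric_trace_eq:
  assumes "\<And>u. linear (b u)"
  shows "metric_trace g x b = (\<Sum>i\<in>Basis. b i (dual g x i))"
  unfolding metric_trace_def
  by (intro sum.cong refl linear_expand_Basis[OF assms, symmetric])

lemma metric_trace_flip: "metric_trace g x (\<lambda>u v. b v u) = metric_trace g x b"
proof -
  have "metric_trace g x (\<lambda>u v. b v u) = (\<Sum>j\<in>Basis. \<Sum>i\<in>Basis. (dual g x i \<bullet> j) *\<^sub>R b j i)"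
    unfolding metric_trace_def by (rule sum.swap)
  also have "\<dots> = metric_trace g x b"
    unfolding metric_trace_def by (intro sum.cong refl arg_cong2[of _ _ _ _ scaleR] dual_symmetric)
  finally show ?thesis .
qed

lemma linear_metric: "linear (\<lambda>v. L u \<bullet> L v)" "linear (\<lambda>v. L v \<bullet> L u)"
  by (auto intro!: linearI simp: linear_add[OF linear] linear_scale[OF linear] inner_add)

text \<open>Contraction with the metric: \<open>g\<^sup>i\<^sup>j g\<^sub>j\<^sub>k l\<^sub>i = l\<^sub>k\<close>.\<close>

lemma metric_trace_contract:
  assumes l: "linear l"
  shows "metric_trace g x (\<lambda>u v. (L v \<bullet> L w) *\<^sub>R l u) = l w"
proof -
  have "linear (\<lambda>v. (L v \<bullet> L w) *\<^sub>R l u)" for u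
    by (auto intro!: linearI
        simp: linear_add[OF linear] linear_scale[OF linear] inner_add_left scaleR_left_distrib)
  then have "metric_trace g x (\<lambda>u v. (L v \<bullet> L w) *\<^sub>R l u) = (\<Sum>i\<in>Basis. (w \<bullet> i) *\<^sub>R l i)"
    by (simp add: metric_trace_eq metric_dual)
  then show ?thesis using linear_expand_Basis[OF l, of w] by argo
qed

lemma metric_trace_contract':
  assumes l: "linear l"
  shows "metric_trace g x (\<lambda>u v. (L u \<bullet> L w) *\<^sub>R l v) = l w"
  using metric_trace_contract[OF l] metric_trace_flip[of "\<lambda>u v. (L v \<bullet> L w) *\<^sub>R l u"] by simp

lemma metric_trace_metric: "metric_trace g x (\<lambda>u v. L u \<bullet> L v) = real DIM('m)"
proof -
  have "metric_trace g x (\<lambda>u v. L u \<bullet> L v) = (\<Sum>i\<in>Basis. L i \<bullet> L (dual g x i))"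
    by (rule metric_trace_eq) (rule linear_metric)
  also have "\<dots> = (\<Sum>i\<in>(Basis :: 'm set). 1)"
    by (intro sum.cong refl) (simp add: inner_commute[of "L _" "L (raise _ _ _)"] metric_dual)
  finally show ?thesis by simp
qed

end

lemma metric_trace_linear:
  assumes "linear T"
  shows "T (metric_trace g x b) = metric_trace g x (\<lambda>u v. T (b u v))"
  unfolding metric_trace_def by (simp add: linear_sum[OF assms] linear_scale[OF assms])

lemma metric_trace_diff:
  "metric_trace g x (\<lambda>u v. b u v - b' u v) = metric_trace g x b - metric_trace g x b'"
  unfolding metric_trace_def by (simp add: scaleR_right_diff_distrib sum_subtractf)

lemma metric_trace_inner:
  "metric_trace g x b \<bullet> a = metric_trace g x (\<lambda>u v. b u v \<bullet> a)"
  unfolding metric_trace_def by (simp add: inner_sum_left)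

lemma metric_trace_mult:
  fixes b :: "'m::euclidean_space \<Rightarrow> 'm \<Rightarrow> real"
  shows "metric_trace g x (\<lambda>u v. k * b u v) = k * metric_trace g x b"
  unfolding metric_trace_def by (simp add: sum_distrib_left mult.left_commute)

lemma metric_trace_minus:
  "metric_trace g x (\<lambda>u v. - b u v) = - metric_trace g x b"
  unfolding metric_trace_def by (simp add: sum_negf)

section \<open>Immersions into a Euclidean space\<close>

definition metric_of :: "('m::euclidean_space \<Rightarrow> 'a::euclidean_space) \<Rightarrow> 'm metric" where
  "metric_of \<Phi> = (\<lambda>x u v. D \<Phi> x u \<bullet> D \<Phi> x v)"

text \<open>A product rule in which one factor is merely continuous, but the other one vanishes at the
  point. It yields the derivative of an inverse matrix from its continuity.\<close>

lemma has_derivative_vanishing_scaleR: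
  fixes f :: "'a::real_normed_vector \<Rightarrow> real" and r :: "'a \<Rightarrow> 'b::real_normed_vector"
  assumes f: "(f has_derivative f') (at x)" and f0: "f x = 0" and r: "isCont r x"
  shows "((\<lambda>y. f y *\<^sub>R r y) has_derivative (\<lambda>v. f' v *\<^sub>R r x)) (at x)"
proof -
  let ?q = "\<lambda>y. norm (f y - f' (y - x)) / norm (y - x)"
  have bl: "bounded_linear f'" and q: "(?q \<longlongrightarrow> 0) (at x)"
    using f by (auto simp: has_derivative_iff_norm f0)
  obtain K where K: "\<And>v. norm (f' v) \<le> norm v * K"
    using bounded_linear.bounded[OF bl] by blast
  have rl: "((\<lambda>y. norm (r y - r x)) \<longlongrightarrow> 0) (at x)"
    using r by (simp add: isCont_def tendsto_norm_zero LIM_zero)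
  have "((\<lambda>y. (K + ?q y) * norm (r y - r x) + ?q y * norm (r x)) \<longlongrightarrow> (K + 0) * 0 + 0 * norm (r x)) (at x)"
    by (intro tendsto_intros q rl)
  then have lim: "((\<lambda>y. (K + ?q y) * norm (r y - r x) + ?q y * norm (r x)) \<longlongrightarrow> 0) (at x)"
    by (simp only: mult_zero_right mult_zero_left add_0_right)
  have "norm (norm (f y *\<^sub>R r y - f x *\<^sub>R r x - f' (y - x) *\<^sub>R r x) / norm (y - x))
      \<le> (K + ?q y) * norm (r y - r x) + ?q y * norm (r x)" if "y \<noteq> x" for y
  proof -
    have n: "norm (y - x) > 0" using that by simp
    have "f y *\<^sub>R r y - f x *\<^sub>R r x - f' (y - x) *\<^sub>R r x
        = f y *\<^sub>R (r y - r x) + (f y - f' (y - x)) *\<^sub>R r x"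
      by (simp add: f0 algebra_simps)
    then have "norm (f y *\<^sub>R r y - f x *\<^sub>R r x - f' (y - x) *\<^sub>R r x)
        \<le> norm (f y) * norm (r y - r x) + norm (f y - f' (y - x)) * norm (r x)"
      by (metis norm_triangle_ineq norm_scaleR real_norm_def)
    also have "norm (f y) \<le> norm (y - x) * (K + ?q y)"
      using norm_triangle_ineq[of "f' (y - x)" "f y - f' (y - x)"] K[of "y - x"] n
      by (simp add: algebra_simps)
    finally have "norm (f y *\<^sub>R r y - f x *\<^sub>R r x - f' (y - x) *\<^sub>R r x)
        \<le> norm (y - x) * (K + ?q y) * norm (r y - r x) + norm (f y - f' (y - x)) * norm (r x)"
      by (simp add: mult_right_mono)
    from divide_right_mono[OF this, of "norm (y - x)"] n show ?thesis
      by (simp add: add_divide_distrib)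
  qed
  then have ev: "\<forall>\<^sub>F y in at x. norm (norm (f y *\<^sub>R r y - f x *\<^sub>R r x - f' (y - x) *\<^sub>R r x) / norm (y - x))
      \<le> (K + ?q y) * norm (r y - r x) + ?q y * norm (r x)"
    by (simp add: eventually_at_filter)
  from Lim_null_comparison[OF ev lim]
  show ?thesis
    unfolding has_derivative_iff_norm
    using bounded_linear_scaleR_left[THEN bounded_linear_compose, OF bl] by blast
qed

locale immersion =
  fixes \<Omega> :: "'m::euclidean_space set" and \<Phi> :: "'m \<Rightarrow> 'a::euclidean_space"
  assumes open_domain: "open \<Omega>" and smooth: "smooth_on \<Omega> \<Phi>"
    and inj_D: "x \<in> \<Omega> \<Longrightarrow> inj (D \<Phi> x)"
begin

abbreviation g :: "'m metric" where "g \<equiv> metric_of \<Phi>"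

lemma differentiable: "x \<in> \<Omega> \<Longrightarrow> \<Phi> differentiable (at x)"
  by (rule smooth_on_differentiable[OF smooth])

lemma injective_linear_D: "x \<in> \<Omega> \<Longrightarrow> injective_linear (D \<Phi> x) g x"
  by (intro injective_linear.intro linear_D differentiable inj_D) (simp_all add: metric_of_def)

lemma smooth_D: "smooth_on \<Omega> (\<lambda>x. D \<Phi> x u)"
  by (rule smooth_on_D[OF smooth])

lemma smooth_metric: "smooth_on \<Omega> (\<lambda>x. g x u v)"
  unfolding metric_of_def by (intro smooth_on_inner open_domain smooth_D)

lemma D_metric:
  assumes x: "x \<in> \<Omega>"
  shows "D (\<lambda>y. g y u v) x w = D2 \<Phi> x w u \<bullet> D \<Phi> x v + D \<Phi> x u \<bullet> D2 \<Phi> x w v"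
  unfolding metric_of_def
  by (rule D_eq[THEN trans, OF has_derivative_inner[OF smooth_on_has_derivative[OF smooth_D x]
          smooth_on_has_derivative[OF smooth_D x]]]) simp

text \<open>The difference of a dual vector at two points, expanded in the dual basis: the coefficients
  are differences of the metric, which are known to be smooth.\<close>

lemma dual_difference:
  assumes "x \<in> \<Omega>" "y \<in> \<Omega>"
  shows "dual g y i - dual g x i = (\<Sum>j\<in>Basis. (g x (dual g x i) j - g y (dual g x i) j) *\<^sub>R dual g y j)"
proof -
  interpret X: injective_linear "D \<Phi> x" g x by (rule injective_linear_D) fact
  interpret Y: injective_linear "D \<Phi> y" g y by (rule injective_linear_D) fact
  have "dual g y i - dual g x i = (\<Sum>j\<in>Basis. (D \<Phi> y (dual g y i - dual g x i) \<bullet> D \<Phi> y j) *\<^sub>R dual g y j)"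
    by (rule Y.expand_dual)
  also have "\<dots> = (\<Sum>j\<in>Basis. (g x (dual g x i) j - g y (dual g x i) j) *\<^sub>R dual g y j)"
    by (simp add: linear_diff[OF Y.linear] inner_diff_left Y.metric_dual X.metric_dual X.g Y.g)
  finally show ?thesis .
qed

text \<open>Let \<open>R\<close> be the total size of the dual basis and \<open>E\<close> that of the coefficients in
  \<open>dual_difference\<close>, which tends to \<open>0\<close>. Then \<open>R(y) \<le> R(x) + m E(y) R(y)\<close>, so \<open>R\<close> is
  bounded by \<open>2 R(x)\<close> near \<open>x\<close>, and the differences are bounded by \<open>2 E(y) R(x)\<close>.\<close>

lemma isCont_dual:
  assumes x: "x \<in> \<Omega>"
  shows "isCont (\<lambda>y. dual g y i) x"
proof -
  define E where "E = (\<lambda>y. \<Sum>i\<in>Basis. \<Sum>j\<in>Basis. \<bar>g x (dual g x i) j - g y (dual g x i) j\<bar>)"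
  define R where "R = (\<lambda>y. \<Sum>i\<in>Basis. norm (dual g y i))"
  have R0: "R y \<ge> 0" and E0: "E y \<ge> 0" for y by (auto simp: R_def E_def intro!: sum_nonneg)
  have E: "(E \<longlongrightarrow> 0) (at x)"
  proof -
    have "((\<lambda>y. g y v w) \<longlongrightarrow> g x v w) (at x)" for v w
      using smooth_on_differentiable[OF smooth_metric x, THEN differentiable_imp_continuous_within]
      by (simp add: continuous_at)
    then have "(E \<longlongrightarrow> (\<Sum>i\<in>Basis. \<Sum>j\<in>Basis. \<bar>g x (dual g x i) j - g x (dual g x i) j\<bar>)) (at x)"
      unfolding E_def by (intro tendsto_intros)
    then show ?thesis by simp
  qed
  have diff: "norm (dual g y k - dual g x k) \<le> E y * R y" if "y \<in> \<Omega>" "k \<in> Basis" for y k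
  proof -
    have "norm (dual g y k - dual g x k)
        \<le> (\<Sum>j\<in>Basis. \<bar>g x (dual g x k) j - g y (dual g x k) j\<bar> * norm (dual g y j))"
      unfolding dual_difference[OF x that(1)] by (rule sum_norm_le) simp
    also have "\<dots> \<le> (\<Sum>j\<in>Basis. \<bar>g x (dual g x k) j - g y (dual g x k) j\<bar> * R y)"
      unfolding R_def by (intro sum_mono mult_left_mono member_le_sum) auto
    also have "\<dots> = (\<Sum>j\<in>Basis. \<bar>g x (dual g x k) j - g y (dual g x k) j\<bar>) * R y"
      by (simp add: sum_distrib_right)
    also have "\<dots> \<le> E y * R y"
      unfolding E_def using that(2) R0
      by (intro mult_right_mono member_le_sum[of k Basis "\<lambda>k. \<Sum>j\<in>Basis. \<bar>g x (dual g x k) j - g y (dual g x k) j\<bar>"])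
         (auto intro: sum_nonneg)
    finally show ?thesis .
  qed
  have R: "R y \<le> R x + real DIM('m) * E y * R y" if "y \<in> \<Omega>" for y
  proof -
    have "R y \<le> (\<Sum>k\<in>Basis. norm (dual g x k) + E y * R y)"
      unfolding R_def
    proof (rule sum_mono)
      fix k :: 'm assume "k \<in> Basis"
      then show "norm (dual g y k) \<le> norm (dual g x k) + E y * (\<Sum>i\<in>Basis. norm (dual g y i))"
        using diff[OF that \<open>k \<in> Basis\<close>] norm_triangle_sub[of "dual g y k" "dual g x k"]
        by (simp add: R_def)
    qed
    also have "\<dots> = R x + real DIM('m) * E y * R y" by (simp add: sum.distrib R_def)
    finally show ?thesis .
  qed
  have "\<forall>\<^sub>F y in at x. real DIM('m) * E y < 1 / 2"
    using tendsto_mult_right_zero[OF E, of "real DIM('m)"] by (rule order_tendstoD) simp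
  moreover have "\<forall>\<^sub>F y in at x. y \<in> \<Omega>"
    using open_domain x by (rule eventually_at_in_open')
  ultimately have "\<forall>\<^sub>F y in at x. R y \<le> 2 * R x \<and> y \<in> \<Omega>"
  proof eventually_elim
    case (elim y)
    then have "real DIM('m) * E y * R y \<le> 1 / 2 * R y" by (intro mult_right_mono R0) simp
    then show ?case using R[OF elim(2)] elim(2) by simp
  qed
  then have ev: "\<forall>\<^sub>F y in at x. norm (dual g y k - dual g x k) \<le> E y * (2 * R x)" if "k \<in> Basis" for k
  proof eventually_elim
    case (elim y)
    then show ?case using diff[of y k] that mult_left_mono[OF _ E0[of y], of "R y" "2 * R x"] by auto
  qed
  have "isCont (\<lambda>y. dual g y k) x" if "k \<in> Basis" for k
  proof -
    have "((\<lambda>y. E y * (2 * R x)) \<longlongrightarrow> 0) (at x)"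
      using tendsto_mult_left_zero[OF E] by simp
    from Lim_null_comparison[OF ev[OF that] this] show ?thesis
      by (simp add: isCont_def LIM_zero_iff)
  qed
  moreover have "\<forall>\<^sub>F y in nhds x. (\<Sum>k\<in>Basis. (i \<bullet> k) *\<^sub>R dual g y k) = dual g y i"
  proof -
    have "(\<Sum>k\<in>Basis. (i \<bullet> k) *\<^sub>R dual g y k) = dual g y i" if "y \<in> \<Omega>" for y
    proof -
      interpret injective_linear "D \<Phi> y" g y by (rule injective_linear_D) fact
      have "linear (\<lambda>z. z \<bullet> i)"
        by (simp add: bounded_linear.linear bounded_linear_inner_left)
      from raise_expand[OF this] show ?thesis by (simp only: inner_commute[of i])
    qed
    then show ?thesis using eventually_nhds_in_open[OF open_domain x] by (auto elim: eventually_mono)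
  qed
  moreover have "isCont (\<lambda>y. \<Sum>k\<in>Basis. (i \<bullet> k) *\<^sub>R dual g y k) x"
    by (intro continuous_intros calculation(1))
  ultimately show ?thesis
    using isCont_cong[of "\<lambda>y. \<Sum>k\<in>Basis. (i \<bullet> k) *\<^sub>R dual g y k" "\<lambda>y. dual g y i" x] by blast
qed

text \<open>In \<open>dual_difference\<close> the coefficients vanish at \<open>x\<close> and the dual vectors are continuous;
  this gives the usual \<open>D(g\<^sup>-\<^sup>1) = - g\<^sup>-\<^sup>1 (Dg) g\<^sup>-\<^sup>1\<close>.\<close>

lemma D_dual:
  assumes x: "x \<in> \<Omega>"
  shows "((\<lambda>y. dual g y i) has_derivative
    (\<lambda>v. \<Sum>j\<in>Basis. - (\<Sum>k\<in>Basis. (dual g x i \<bullet> k) * D (\<lambda>y. g y k j) x v) *\<^sub>R dual g x j)) (at x)"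
proof -
  have exp: "g y w j = (\<Sum>k\<in>Basis. (w \<bullet> k) * g y k j)" if "y \<in> \<Omega>" for y w j
    using linear_expand_Basis[OF injective_linear.linear_metric(2)[OF injective_linear_D[OF that], of j],
        of w]
    by (simp add: metric_of_def)
  have d: "((\<lambda>y. g x (dual g x i) j - (\<Sum>k\<in>Basis. (dual g x i \<bullet> k) * g y k j)) has_derivative
      (\<lambda>v. - (\<Sum>k\<in>Basis. (dual g x i \<bullet> k) * D (\<lambda>y. g y k j) x v))) (at x)" for j
    using has_derivative_diff[OF has_derivative_const has_derivative_sum[OF
          has_derivative_mult_right[OF smooth_on_has_derivative[OF smooth_metric x]]],
        of "g x (dual g x i) j" "\<lambda>k. dual g x i \<bullet> k" "\<lambda>k. k" "\<lambda>k. j" Basis]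
    by simp
  have "((\<lambda>y. dual g x i + (\<Sum>j\<in>Basis. (g x (dual g x i) j - (\<Sum>k\<in>Basis. (dual g x i \<bullet> k) * g y k j)) *\<^sub>R dual g y j))
     has_derivative (\<lambda>v. 0 + (\<Sum>j\<in>Basis. - (\<Sum>k\<in>Basis. (dual g x i \<bullet> k) * D (\<lambda>y. g y k j) x v) *\<^sub>R dual g x j))) (at x)"
    by (intro has_derivative_add[OF has_derivative_const has_derivative_sum]
        has_derivative_vanishing_scaleR[OF d _ isCont_dual[OF x]])
      (simp add: exp[OF x, of "dual g x i"])
  then have "((\<lambda>y. dual g x i + (\<Sum>j\<in>Basis. (g x (dual g x i) j - (\<Sum>k\<in>Basis. (dual g x i \<bullet> k) * g y k j)) *\<^sub>R dual g y j))
     has_derivative (\<lambda>v. \<Sum>j\<in>Basis. - (\<Sum>k\<in>Basis. (dual g x i \<bullet> k) * D (\<lambda>y. g y k j) x v) *\<^sub>R dual g x j)) (at x)"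
    by simp
  then show ?thesis
  proof (rule has_derivative_transform_within_open[OF _ open_domain x])
    fix y assume y: "y \<in> \<Omega>"
    show "dual g x i + (\<Sum>j\<in>Basis. (g x (dual g x i) j - (\<Sum>k\<in>Basis. (dual g x i \<bullet> k) * g y k j)) *\<^sub>R dual g y j) = dual g y i"
      using dual_difference[OF x y, of i] by (simp add: exp[OF y, of "dual g x i"] diff_eq_eq add.commute)
  qed
qed

text \<open>The derivative of a dual vector is a polynomial in the dual vectors and in derivatives of the
  metric, so each order of differentiability gives the next one.\<close>

lemma smooth_dual: "smooth_on \<Omega> (\<lambda>y. dual g y i)"
proof -
  have "Ck_on k \<Omega> (\<lambda>y. dual g y i)" for k i
  proof (induction k arbitrary: i)
    case 0
    then show ?case by (simp add: continuous_at_imp_continuous_on isCont_dual)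
  next
    case (Suc n)
    have "Ck_on n \<Omega> (\<lambda>x. D (\<lambda>y. g y k j) x v)" for k j v
      using smooth_on_D[OF smooth_metric] by (simp add: smooth_on_def)
    then have "Ck_on n \<Omega> (\<lambda>x. \<Sum>j\<in>Basis. - (\<Sum>k\<in>Basis. (dual g x i \<bullet> k) * D (\<lambda>y. g y k j) x v) *\<^sub>R dual g x j)" for v
      by (intro Ck_on_sum open_domain Ck_on_bilinear[OF bounded_bilinear_scaleR]
          Ck_on_bounded_linear[OF bounded_linear_minus[OF bounded_linear_ident]]
          Ck_on_bilinear[OF bounded_bilinear_mult] Ck_on_bilinear[OF bounded_bilinear_inner]
          Ck_on_const Suc)
    then have "Ck_on n \<Omega> (\<lambda>x. D (\<lambda>y. dual g y i) x v)" for v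
      by (rule Ck_on_cong[OF open_domain, rotated]) (rule D_eq[OF D_dual, symmetric])
    with D_dual show ?case by (auto simp: differentiable_def)
  qed
  then show ?thesis by (simp add: smooth_on_def)
qed

text \<open>The Levi-Civita connection of the induced metric is the tangential part of the
  derivative in the ambient space (the Gauss formula).\<close>

lemma christoffel_tangential:
  assumes x: "x \<in> \<Omega>"
  shows "D \<Phi> x (christoffel g x u v) \<bullet> D \<Phi> x z = D2 \<Phi> x u v \<bullet> D \<Phi> x z"
    and "christoffel g x u v = raise g x (\<lambda>z. D2 \<Phi> x u v \<bullet> D \<Phi> x z)"
proof -
  interpret injective_linear "D \<Phi> x" g x by (rule injective_linear_D[OF x])
  have *: "(\<lambda>z. (D (\<lambda>y. g y v z) x u + D (\<lambda>y. g y u z) x v - D (\<lambda>y. g y u v) x z) / 2)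
      = (\<lambda>z. D2 \<Phi> x u v \<bullet> D \<Phi> x z)"
  proof
    fix z
    show "(D (\<lambda>y. g y v z) x u + D (\<lambda>y. g y u z) x v - D (\<lambda>y. g y u v) x z) / 2
        = D2 \<Phi> x u v \<bullet> D \<Phi> x z"
      unfolding D_metric[OF x] D2_symmetric[OF open_domain smooth x, of v u]
        D2_symmetric[OF open_domain smooth x, of z u] D2_symmetric[OF open_domain smooth x, of z v]
      by (simp add: inner_commute[of "D \<Phi> x _"])
  qed
  show "christoffel g x u v = raise g x (\<lambda>z. D2 \<Phi> x u v \<bullet> D \<Phi> x z)"
    unfolding christoffel_def * ..
  have "linear (\<lambda>z. D2 \<Phi> x u v \<bullet> D \<Phi> x z)"
    by (auto intro!: linearI simp: linear_add[OF linear] linear_scale[OF linear] inner_add_right)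
  from metric_raise[OF this]
  show "D \<Phi> x (christoffel g x u v) \<bullet> D \<Phi> x z = D2 \<Phi> x u v \<bullet> D \<Phi> x z"
    unfolding christoffel_def * .
qed

lemma smooth_christoffel: "smooth_on \<Omega> (\<lambda>x. christoffel g x u v)"
proof (rule smooth_on_cong[OF open_domain])
  show "smooth_on \<Omega> (\<lambda>x. \<Sum>j\<in>Basis. (D2 \<Phi> x u v \<bullet> D \<Phi> x j) *\<^sub>R dual g x j)"
    by (intro smooth_on_sum smooth_on_scaleR smooth_on_inner open_domain smooth_dual smooth_D
        smooth_on_D[OF smooth_D])
  fix x assume x: "x \<in> \<Omega>"
  interpret injective_linear "D \<Phi> x" g x by (rule injective_linear_D[OF x])
  show "(\<Sum>j\<in>Basis. (D2 \<Phi> x u v \<bullet> D \<Phi> x j) *\<^sub>R dual g x j) = christoffel g x u v"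
    unfolding christoffel_tangential(2)[OF x]
    by (rule raise_expand[symmetric])
      (auto intro!: linearI simp: linear_add[OF linear] linear_scale[OF linear] inner_add_right)
qed

lemma smooth_metric_trace:
  assumes "\<And>i j. smooth_on \<Omega> (\<lambda>x. b x i j)"
  shows "smooth_on \<Omega> (\<lambda>x. metric_trace g x (b x))"
  unfolding metric_trace_def
  by (intro smooth_on_sum smooth_on_scaleR smooth_on_inner open_domain smooth_dual smooth_on_const assms)

end

section \<open>The connection and the curvature of the sphere in a chart\<close>

lemma D_D_field:
  fixes f :: "'a::euclidean_space \<Rightarrow> 'b::euclidean_space" and G :: "'b \<Rightarrow> 'c::euclidean_space"
  assumes S: "open S" and x: "x \<in> S" and f_in: "\<And>x. x \<in> S \<Longrightarrow> f x \<in> T" and T: "open T"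
    and G: "smooth_on T G" and f: "smooth_on S f" and s: "smooth_on S s"
  shows "D (\<lambda>y. D G (f y) (s y)) x u = D2 G (f x) (D f x u) (s x) + D G (f x) (D s x u)"
proof -
  note fx = f_in[OF x]
  have 1: "((\<lambda>y. D G (f y) b) has_derivative (\<lambda>u. D2 G (f x) (D f x u) b)) (at x)" for b
    by (rule has_derivative_compose[OF smooth_on_has_derivative[OF f x]
          smooth_on_has_derivative[OF smooth_on_D[OF G] fx]])
  have 2: "((\<lambda>y. s y \<bullet> b) has_derivative (\<lambda>u. D s x u \<bullet> b)) (at x)" for b
    by (rule has_derivative_inner_left[OF smooth_on_has_derivative[OF s x]])
  have "((\<lambda>y. \<Sum>b\<in>Basis. (s y \<bullet> b) *\<^sub>R D G (f y) b) has_derivative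
      (\<lambda>u. \<Sum>b\<in>Basis. (s x \<bullet> b) *\<^sub>R D2 G (f x) (D f x u) b + (D s x u \<bullet> b) *\<^sub>R D G (f x) b)) (at x)"
    by (rule has_derivative_sum, rule has_derivative_scaleR[OF 2 1])
  from D_eq[OF this]
  have "D (\<lambda>y. \<Sum>b\<in>Basis. (s y \<bullet> b) *\<^sub>R D G (f y) b) x u
      = (\<Sum>b\<in>Basis. (s x \<bullet> b) *\<^sub>R D2 G (f x) (D f x u) b) + (\<Sum>b\<in>Basis. (D s x u \<bullet> b) *\<^sub>R D G (f x) b)"
    by (simp only: sum.distrib)
  also have "D (\<lambda>y. \<Sum>b\<in>Basis. (s y \<bullet> b) *\<^sub>R D G (f y) b) x u = D (\<lambda>y. D G (f y) (s y)) x u"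
    by (rule D_cong_open[OF S x], rule linear_expand_Basis[symmetric])
      (rule linear_D[OF smooth_on_differentiable[OF G f_in]])
  also have "(\<Sum>b\<in>Basis. (s x \<bullet> b) *\<^sub>R D2 G (f x) (D f x u) b) = D2 G (f x) (D f x u) (s x)"
    by (rule linear_expand_Basis[symmetric]) (rule linear_D2_right[OF T G fx])
  also have "(\<Sum>b\<in>Basis. (D s x u \<bullet> b) *\<^sub>R D G (f x) b) = D G (f x) (D s x u)"
    by (rule linear_expand_Basis[symmetric]) (rule linear_D[OF smooth_on_differentiable[OF G fx]])
  finally show ?thesis .
qed

text \<open>\<open>\<psi>\<close> is the inverse of a chart of the unit sphere and \<open>G\<close> a smooth extension of the chart
  to an open subset of the ambient space. The extension serves to read off coordinates: \<open>dG\<close> inverts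
  \<open>d\<psi>\<close> on tangent vectors, so a section is smooth in the chart as soon as it is smooth as
  a map into the ambient space.\<close>

locale sphere_chart =
  fixes \<Theta> :: "'n::euclidean_space set" and \<psi> :: "'n \<Rightarrow> 'a::euclidean_space"
    and W :: "'a set" and G :: "'a \<Rightarrow> 'n"
  assumes dim: "DIM('a) = DIM('n) + 1"
    and open_chart: "open \<Theta>" and smooth_chart: "smooth_on \<Theta> \<psi>"
    and open_W: "open W" and smooth_G: "smooth_on W G"
    and chart_in_W: "y \<in> \<Theta> \<Longrightarrow> \<psi> y \<in> W" and G_chart: "y \<in> \<Theta> \<Longrightarrow> G (\<psi> y) = y"
    and chart_unit: "y \<in> \<Theta> \<Longrightarrow> \<psi> y \<bullet> \<psi> y = 1"
begin

lemma D_G_D_chart: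
  assumes y: "y \<in> \<Theta>"
  shows "D G (\<psi> y) (D \<psi> y v) = v"
proof -
  have "((\<lambda>y. G (\<psi> y)) has_derivative (\<lambda>v. D G (\<psi> y) (D \<psi> y v))) (at y)"
    by (rule has_derivative_compose[OF smooth_on_has_derivative[OF smooth_chart y]
          smooth_on_has_derivative[OF smooth_G chart_in_W[OF y]]])
  from D_eq[OF this] have "D G (\<psi> y) (D \<psi> y v) = D (\<lambda>y. G (\<psi> y)) y v" by simp
  also have "\<dots> = D (\<lambda>y. y) y v" by (rule D_cong_open[OF open_chart y G_chart])
  finally show ?thesis by simp
qed

sublocale chart: immersion \<Theta> \<psi>
proof (rule immersion.intro[OF open_chart smooth_chart])
  show "inj (D \<psi> y)" if "y \<in> \<Theta>" for y
    by (rule inj_on_inverseI[where g = "D G (\<psi> y)"]) (rule D_G_D_chart[OF that])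
qed

abbreviation h :: "'n metric" where "h \<equiv> metric_of \<psi>"

lemma D_chart_normal:
  assumes y: "y \<in> \<Theta>"
  shows "D \<psi> y v \<bullet> \<psi> y = 0"
proof -
  have "D (\<lambda>y. \<psi> y \<bullet> \<psi> y) y v = D (\<lambda>y. 1) y v"
    by (rule D_cong_open[OF open_chart y chart_unit])
  moreover have "D (\<lambda>y. \<psi> y \<bullet> \<psi> y) y v = \<psi> y \<bullet> D \<psi> y v + D \<psi> y v \<bullet> \<psi> y"
    by (rule D_eq[OF has_derivative_inner[OF smooth_on_has_derivative[OF smooth_chart y]
            smooth_on_has_derivative[OF smooth_chart y]]])
  ultimately show ?thesis by (simp add: inner_commute)
qed

text \<open>The tangent space of the sphere is the whole hyperplane, by comparison of dimensions. It is
  here that the chart is required to have codimension one.\<close>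

lemma range_D_chart:
  assumes y: "y \<in> \<Theta>"
  shows "range (D \<psi> y) = {v. \<psi> y \<bullet> v = 0}"
proof (rule subspace_dim_equal)
  have lin: "linear (D \<psi> y)" by (rule linear_D[OF chart.differentiable[OF y]])
  show "subspace (range (D \<psi> y))" by (rule linear_subspace_image[OF lin subspace_UNIV])
  show "subspace {v. \<psi> y \<bullet> v = 0}" by (rule subspace_hyperplane)
  show "range (D \<psi> y) \<subseteq> {v. \<psi> y \<bullet> v = 0}"
    using D_chart_normal[OF y] by (auto simp: inner_commute)
  have "\<psi> y \<noteq> 0" using chart_unit[OF y] by auto
  then have "dim {v. \<psi> y \<bullet> v = 0} = DIM('n)" by (simp add: dim_hyperplane dim)
  also have "\<dots> = dim (range (D \<psi> y))"
    using dim_image_eq[OF lin, of UNIV] chart.inj_D[OF y] by simp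
  finally show "dim {v. \<psi> y \<bullet> v = 0} \<le> dim (range (D \<psi> y))" by simp
qed

lemma D_chart_D_G:
  assumes y: "y \<in> \<Theta>" and v: "v \<bullet> \<psi> y = 0"
  shows "D \<psi> y (D G (\<psi> y) v) = v"
proof -
  have "v \<in> range (D \<psi> y)" using range_D_chart[OF y] v by (simp add: inner_commute)
  then obtain w where "v = D \<psi> y w" by blast
  then show ?thesis by (simp add: D_G_D_chart[OF y])
qed

text \<open>A vector tangent to the sphere that has the same inner products with tangent vectors as \<open>b\<close>
  is the orthogonal projection of \<open>b\<close> to the tangent space.\<close>

lemma tangential_projection:
  assumes y: "y \<in> \<Theta>" and a: "a \<bullet> \<psi> y = 0" and ab: "\<And>z. a \<bullet> D \<psi> y z = b \<bullet> D \<psi> y z"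
  shows "a = b - (b \<bullet> \<psi> y) *\<^sub>R \<psi> y"
proof -
  let ?d = "a - (b - (b \<bullet> \<psi> y) *\<^sub>R \<psi> y)"
  have "?d \<bullet> \<psi> y = 0" using a chart_unit[OF y] by (simp add: inner_diff_left)
  then have "?d = D \<psi> y (D G (\<psi> y) ?d)" using D_chart_D_G[OF y] by simp
  then obtain z where z: "?d = D \<psi> y z" by blast
  have "?d \<bullet> ?d = ?d \<bullet> D \<psi> y z" by (simp only: z)
  also have "\<dots> = 0"
    using ab[of z] D_chart_normal[OF y, of z]
    by (simp add: inner_diff_left inner_commute[of "\<psi> y"])
  finally show ?thesis by simp
qed

end

text \<open>A smooth map \<open>\<Phi>\<close> into the sphere, with values in the domain of a chart in which
  it is expressed by \<open>F\<close>. A section of the pulled-back tangent bundle is described either by its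
  components \<open>\<sigma>\<close> in the chart or by the field \<open>s\<close> of ambient vectors
  orthogonal to \<open>\<Phi>\<close>; these determine each other by \<open>\<sigma> = dG(s)\<close> and \<open>s = d\<psi>(\<sigma>)\<close>.\<close>

locale sphere_map = sphere_chart \<Theta> \<psi> W G
  for \<Theta> :: "'n::euclidean_space set" and \<psi> :: "'n \<Rightarrow> 'a::euclidean_space" and W G +
  fixes \<Omega> :: "'m::euclidean_space set" and \<Phi> :: "'m \<Rightarrow> 'a" and F :: "'m \<Rightarrow> 'n"
  assumes open_\<Omega>: "open \<Omega>" and smooth_map: "smooth_on \<Omega> \<Phi>"
    and F_in: "x \<in> \<Omega> \<Longrightarrow> F x \<in> \<Theta>" and chart_F: "x \<in> \<Omega> \<Longrightarrow> \<psi> (F x) = \<Phi> x"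
begin

lemma map_in_W: "x \<in> \<Omega> \<Longrightarrow> \<Phi> x \<in> W"
  using chart_in_W[OF F_in] by (simp add: chart_F)

lemma F_eq: "x \<in> \<Omega> \<Longrightarrow> F x = G (\<Phi> x)"
  using G_chart[OF F_in] by (simp add: chart_F)

lemma map_unit: "x \<in> \<Omega> \<Longrightarrow> \<Phi> x \<bullet> \<Phi> x = 1"
  using chart_unit[OF F_in] by (simp add: chart_F)

lemma smooth_F: "smooth_on \<Omega> F"
  by (rule smooth_on_cong[OF open_\<Omega> smooth_on_compose[OF open_\<Omega> map_in_W smooth_G smooth_map]])
    (simp_all add: F_eq)

lemma D_F:
  assumes x: "x \<in> \<Omega>"
  shows "D F x v = D G (\<Phi> x) (D \<Phi> x v)" and "D \<psi> (F x) (D F x v) = D \<Phi> x v"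
proof -
  have "D F x v = D (\<lambda>x. G (\<Phi> x)) x v" by (rule D_cong_open[OF open_\<Omega> x F_eq])
  also have "\<dots> = D G (\<Phi> x) (D \<Phi> x v)"
    by (rule D_eq[OF has_derivative_compose[OF smooth_on_has_derivative[OF smooth_map x]
          smooth_on_has_derivative[OF smooth_G map_in_W[OF x]]]])
  finally show "D F x v = D G (\<Phi> x) (D \<Phi> x v)" .
  have "D \<psi> (F x) (D F x v) = D (\<lambda>x. \<psi> (F x)) x v"
    by (rule D_eq[OF has_derivative_compose[OF smooth_on_has_derivative[OF smooth_F x]
          smooth_on_has_derivative[OF smooth_chart F_in[OF x]]], symmetric])
  also have "\<dots> = D \<Phi> x v" by (rule D_cong_open[OF open_\<Omega> x chart_F])
  finally show "D \<psi> (F x) (D F x v) = D \<Phi> x v" .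
qed

lemma D_map_normal:
  assumes x: "x \<in> \<Omega>"
  shows "D \<Phi> x v \<bullet> \<Phi> x = 0"
  using D_chart_normal[OF F_in[OF x], of "D F x v"] by (simp add: D_F(2)[OF x] chart_F[OF x])

lemma D_chart_components:
  assumes x: "x \<in> \<Omega>" and s: "s \<bullet> \<Phi> x = 0"
  shows "D \<psi> (F x) (D G (\<Phi> x) s) = s"
  using D_chart_D_G[OF F_in[OF x], of s] s by (simp add: chart_F[OF x])

lemma components_D_chart:
  assumes x: "x \<in> \<Omega>"
  shows "D G (\<Phi> x) (D \<psi> (F x) v) = v"
  using D_G_D_chart[OF F_in[OF x], of v] by (simp add: chart_F[OF x])

text \<open>The pulled-back connection differentiates \<open>s\<close> in the ambient space and projects to the
  tangent space of the sphere; the normal component of \<open>Ds\<close> is found by differentiating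
  \<open>s \<bullet> \<Phi> = 0\<close>.\<close>

lemma pullback_nabla_ambient:
  assumes x: "x \<in> \<Omega>" and s: "smooth_on \<Omega> s" and s_normal: "\<And>y. y \<in> \<Omega> \<Longrightarrow> s y \<bullet> \<Phi> y = 0"
    and \<sigma>: "\<And>y. y \<in> \<Omega> \<Longrightarrow> \<sigma> y = D G (\<Phi> y) (s y)"
  shows "D \<psi> (F x) (pullback_nabla h F \<sigma> x u) = D s x u + (s x \<bullet> D \<Phi> x u) *\<^sub>R \<Phi> x"
proof -
  note Fx = F_in[OF x]
  interpret X: injective_linear "D \<psi> (F x)" h "F x" by (rule chart.injective_linear_D[OF Fx])
  have sm\<sigma>: "smooth_on \<Omega> \<sigma>"
    by (rule smooth_on_cong[OF open_\<Omega> smooth_on_D_field[OF open_\<Omega> map_in_W smooth_G smooth_map s]])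
      (simp_all add: \<sigma>)
  have "D s x u = D (\<lambda>y. D \<psi> (F y) (\<sigma> y)) x u"
    by (rule D_cong_open[OF open_\<Omega> x]) (simp add: \<sigma> D_chart_components s_normal)
  also have "\<dots> = D2 \<psi> (F x) (D F x u) (\<sigma> x) + D \<psi> (F x) (D \<sigma> x u)"
    by (rule D_D_field[OF open_\<Omega> x F_in open_chart smooth_chart smooth_F sm\<sigma>])
  finally have Ds: "D s x u = D2 \<psi> (F x) (D F x u) (\<sigma> x) + D \<psi> (F x) (D \<sigma> x u)" .
  have "D (\<lambda>y. s y \<bullet> \<Phi> y) x u = D (\<lambda>y. 0) x u"
    by (rule D_cong_open[OF open_\<Omega> x s_normal])
  moreover have "D (\<lambda>y. s y \<bullet> \<Phi> y) x u = s x \<bullet> D \<Phi> x u + D s x u \<bullet> \<Phi> x"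
    by (rule D_eq[OF has_derivative_inner[OF smooth_on_has_derivative[OF s x]
          smooth_on_has_derivative[OF smooth_map x]]])
  ultimately have n: "D s x u \<bullet> \<Phi> x = - (s x \<bullet> D \<Phi> x u)" by simp
  have "D \<psi> (F x) (pullback_nabla h F \<sigma> x u) = D s x u - (D s x u \<bullet> \<psi> (F x)) *\<^sub>R \<psi> (F x)"
  proof (rule tangential_projection[OF Fx D_chart_normal[OF Fx]])
    fix z
    show "D \<psi> (F x) (pullback_nabla h F \<sigma> x u) \<bullet> D \<psi> (F x) z = D s x u \<bullet> D \<psi> (F x) z"
      unfolding pullback_nabla_def Ds
      by (simp add: linear_add[OF X.linear] inner_add_left chart.christoffel_tangential(1)[OF Fx])
  qed
  then show ?thesis by (simp add: chart_F[OF x] n)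
qed

lemma pullback_nabla_components:
  assumes x: "x \<in> \<Omega>" and s: "smooth_on \<Omega> s" and s_normal: "\<And>y. y \<in> \<Omega> \<Longrightarrow> s y \<bullet> \<Phi> y = 0"
    and \<sigma>: "\<And>y. y \<in> \<Omega> \<Longrightarrow> \<sigma> y = D G (\<Phi> y) (s y)"
  shows "pullback_nabla h F \<sigma> x u = D G (\<Phi> x) (D s x u + (s x \<bullet> D \<Phi> x u) *\<^sub>R \<Phi> x)"
    and "(D s x u + (s x \<bullet> D \<Phi> x u) *\<^sub>R \<Phi> x) \<bullet> \<Phi> x = 0"
  using pullback_nabla_ambient[OF assms, of u] components_D_chart[OF x, of "pullback_nabla h F \<sigma> x u"]
    D_chart_normal[OF F_in[OF x], of "pullback_nabla h F \<sigma> x u"]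
  by (simp_all add: chart_F[OF x])

end

context sphere_chart
begin

interpretation identity: sphere_map \<Theta> \<psi> W G \<Theta> \<psi> "\<lambda>y. y"
  by unfold_locales (auto intro: open_chart smooth_chart)

text \<open>The unit sphere has constant curvature \<open>1\<close>.\<close>

lemma curvature_sphere:
  assumes y: "y \<in> \<Theta>"
  shows "D \<psi> y (curvature h y u v w)
    = (D \<psi> y v \<bullet> D \<psi> y w) *\<^sub>R D \<psi> y u - (D \<psi> y u \<bullet> D \<psi> y w) *\<^sub>R D \<psi> y v"
proof -
  interpret Y: injective_linear "D \<psi> y" h y by (rule chart.injective_linear_D[OF y])
  let ?s = "\<lambda>v z. D2 \<psi> z v w + (D \<psi> z w \<bullet> D \<psi> z v) *\<^sub>R \<psi> z"
  have nabla: "nabla h (\<lambda>_. v) Z z = pullback_nabla h (\<lambda>y. y) Z z v" for v Z z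
    by (simp add: nabla_def pullback_nabla_def)
  have sm: "smooth_on \<Theta> (\<lambda>z. D \<psi> z v)" for v by (rule chart.smooth_D)
  have sms: "smooth_on \<Theta> (?s v)" for v
    by (intro smooth_on_add smooth_on_scaleR smooth_on_inner open_chart smooth_chart smooth_on_D)
  have w: "w = D G (\<psi> z) (D \<psi> z w)" if "z \<in> \<Theta>" for z by (simp add: D_G_D_chart[OF that])
  have first: "nabla h (\<lambda>_. v) (\<lambda>_. w) z = D G (\<psi> z) (?s v z)" "?s v z \<bullet> \<psi> z = 0" if "z \<in> \<Theta>" for v z
    unfolding nabla
    using identity.pullback_nabla_components[OF that sm D_chart_normal w] by blast+
  have D_metric: "((\<lambda>z. D \<psi> z w \<bullet> D \<psi> z v) has_derivative
      (\<lambda>u. D \<psi> y w \<bullet> D2 \<psi> y u v + D2 \<psi> y u w \<bullet> D \<psi> y v)) (at y)" for v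
    by (rule has_derivative_inner[OF smooth_on_has_derivative[OF sm y] smooth_on_has_derivative[OF sm y]])
  have Ds: "D (?s v) y u = D (\<lambda>z. D2 \<psi> z v w) y u + ((D \<psi> y w \<bullet> D \<psi> y v) *\<^sub>R D \<psi> y u
      + (D \<psi> y w \<bullet> D2 \<psi> y u v + D2 \<psi> y u w \<bullet> D \<psi> y v) *\<^sub>R \<psi> y)" for u v
    by (rule D_eq[OF has_derivative_add[OF smooth_on_has_derivative[OF smooth_on_D[OF sm] y]
          has_derivative_scaleR[OF D_metric smooth_on_has_derivative[OF smooth_chart y]]]])
  have second: "D \<psi> y (nabla h (\<lambda>_. u) (nabla h (\<lambda>_. v) (\<lambda>_. w)) y)
      = D (\<lambda>z. D2 \<psi> z v w) y u + (D \<psi> y w \<bullet> D \<psi> y v) *\<^sub>R D \<psi> y u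
      + (D \<psi> y w \<bullet> D2 \<psi> y u v + D2 \<psi> y u w \<bullet> D \<psi> y v + D2 \<psi> y v w \<bullet> D \<psi> y u) *\<^sub>R \<psi> y" for u v
  proof -
    have "D \<psi> y (nabla h (\<lambda>_. u) (nabla h (\<lambda>_. v) (\<lambda>_. w)) y)
        = D (?s v) y u + (?s v y \<bullet> D \<psi> y u) *\<^sub>R \<psi> y"
      unfolding nabla[of u]
      by (rule identity.pullback_nabla_ambient[OF y sms first(2) first(1)])
    also have "\<dots> = D (\<lambda>z. D2 \<psi> z v w) y u + (D \<psi> y w \<bullet> D \<psi> y v) *\<^sub>R D \<psi> y u
      + (D \<psi> y w \<bullet> D2 \<psi> y u v + D2 \<psi> y u w \<bullet> D \<psi> y v + D2 \<psi> y v w \<bullet> D \<psi> y u) *\<^sub>R \<psi> y"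
      unfolding Ds using D_chart_normal[OF y, of u]
      by (simp add: inner_add_left inner_commute[of "\<psi> y"] scaleR_add_left)
    finally show ?thesis .
  qed
  have bracket: "nabla h (lie_bracket (\<lambda>_. u) (\<lambda>_. v)) (\<lambda>_. w) y = 0"
  proof -
    have "lie_bracket (\<lambda>_. u) (\<lambda>_. v) = (\<lambda>_. 0)" by (simp add: lie_bracket_def fun_eq_iff)
    moreover have "christoffel h y 0 w = 0"
      unfolding chart.christoffel_tangential(2)[OF y]
      by (rule Y.raise_eqI)
        (simp add: linear_0[OF Y.linear] linear_0[OF linear_D2_left[OF smooth_chart y]])
    ultimately show ?thesis by (simp add: nabla_def)
  qed
  have sym3: "D (\<lambda>z. D2 \<psi> z v w) y u = D (\<lambda>z. D2 \<psi> z u w) y v"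
    by (rule D2_symmetric[OF open_chart sm y])
  have sym2: "D2 \<psi> y u v = D2 \<psi> y v u"
    by (rule D2_symmetric[OF open_chart smooth_chart y])
  have "D \<psi> y (curvature h y u v w) = D \<psi> y (nabla h (\<lambda>_. u) (nabla h (\<lambda>_. v) (\<lambda>_. w)) y)
      - D \<psi> y (nabla h (\<lambda>_. v) (nabla h (\<lambda>_. u) (\<lambda>_. w)) y)"
    unfolding curvature_def curvature_fields_def bracket by (simp add: linear_diff[OF Y.linear])
  also have "\<dots> = (D \<psi> y v \<bullet> D \<psi> y w) *\<^sub>R D \<psi> y u - (D \<psi> y u \<bullet> D \<psi> y w) *\<^sub>R D \<psi> y v"
    unfolding second sym3 sym2 by (simp add: inner_commute[of "D \<psi> y w"] algebra_simps)
  finally show ?thesis .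
qed

end

section \<open>Submanifolds of the sphere\<close>

locale sphere_immersion = sphere_map \<Theta> \<psi> W G \<Omega> \<Phi> F
  for \<Theta> :: "'n::euclidean_space set" and \<psi> :: "'n \<Rightarrow> 'a::euclidean_space" and W G
    and \<Omega> :: "'m::euclidean_space set" and \<Phi> :: "'m \<Rightarrow> 'a" and F +
  assumes inj_D_map: "x \<in> \<Omega> \<Longrightarrow> inj (D \<Phi> x)"
begin

sublocale source: immersion \<Omega> \<Phi>
  by (rule immersion.intro[OF open_\<Omega> smooth_map inj_D_map])

abbreviation g :: "'m metric" where "g \<equiv> metric_of \<Phi>"

text \<open>The second fundamental form of \<open>\<Phi>\<close> in the sphere and its trace, the tension field, as vectors of
  the ambient space. The summand along \<open>\<Phi>\<close> removes the second fundamental form of the sphere.\<close>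

definition B :: "'m \<Rightarrow> 'm \<Rightarrow> 'm \<Rightarrow> 'a" where
  "B x u v = D2 \<Phi> x u v + (D \<Phi> x u \<bullet> D \<Phi> x v) *\<^sub>R \<Phi> x - D \<Phi> x (christoffel g x u v)"

definition t :: "'m \<Rightarrow> 'a" where
  "t x = metric_trace g x (B x)"

lemma smooth_B: "smooth_on \<Omega> (\<lambda>x. B x u v)"
  unfolding B_def
  by (intro smooth_on_diff smooth_on_add smooth_on_scaleR smooth_on_inner smooth_on_D smooth_map
      smooth_on_D_field[where f = "\<lambda>x. x" and T = \<Omega>] smooth_on_ident source.smooth_christoffel open_\<Omega>)

lemma smooth_t: "smooth_on \<Omega> t"
  unfolding t_def by (rule source.smooth_metric_trace[OF smooth_B])

lemma D2_map_normal:
  assumes x: "x \<in> \<Omega>"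
  shows "D2 \<Phi> x u v \<bullet> \<Phi> x = - (D \<Phi> x u \<bullet> D \<Phi> x v)"
proof -
  have "D (\<lambda>y. D \<Phi> y v \<bullet> \<Phi> y) x u = D (\<lambda>y. 0) x u"
    by (rule D_cong_open[OF open_\<Omega> x D_map_normal])
  moreover have "D (\<lambda>y. D \<Phi> y v \<bullet> \<Phi> y) x u = D \<Phi> x v \<bullet> D \<Phi> x u + D2 \<Phi> x u v \<bullet> \<Phi> x"
    by (rule D_eq[OF has_derivative_inner[OF smooth_on_has_derivative[OF source.smooth_D x]
          smooth_on_has_derivative[OF smooth_map x]]])
  ultimately show ?thesis by (simp add: inner_commute)
qed

lemma B_normal:
  assumes x: "x \<in> \<Omega>"
  shows "B x u v \<bullet> \<Phi> x = 0" and "B x u v \<bullet> D \<Phi> x z = 0"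
  unfolding B_def using D_map_normal[OF x, of z]
  by (simp_all add: inner_add_left inner_diff_left D2_map_normal[OF x] map_unit[OF x]
      D_map_normal[OF x] source.christoffel_tangential(1)[OF x] inner_commute[of "\<Phi> x" "D \<Phi> x z"])

lemma metric_trace_zero: "metric_trace g x (\<lambda>u v. 0) = 0"
  by (simp add: metric_trace_def)

lemma t_normal:
  assumes x: "x \<in> \<Omega>"
  shows "t x \<bullet> \<Phi> x = 0" and "t x \<bullet> D \<Phi> x z = 0"
  unfolding t_def metric_trace_inner by (simp_all add: B_normal[OF x] metric_trace_zero)

lemma nabla_d_ambient:
  assumes x: "x \<in> \<Omega>"
  shows "D \<psi> (F x) (nabla_d g h F x u v) = B x u v"
proof -
  have "linear (D \<psi> (F x))" by (rule linear_D[OF chart.differentiable[OF F_in[OF x]]])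
  then show ?thesis
    unfolding nabla_d_def B_def
    using pullback_nabla_ambient[where s = "\<lambda>y. D \<Phi> y v" and \<sigma> = "\<lambda>y. D F y v" and u = u,
        OF x source.smooth_D D_map_normal D_F(1)]
    by (simp add: linear_diff D_F(2)[OF x] inner_commute)
qed

lemma tension_ambient:
  assumes x: "x \<in> \<Omega>"
  shows "D \<psi> (F x) (tension g h F x) = t x" and "tension g h F x = D G (\<Phi> x) (t x)"
proof -
  have "linear (D \<psi> (F x))" by (rule linear_D[OF chart.differentiable[OF F_in[OF x]]])
  then show *: "D \<psi> (F x) (tension g h F x) = t x"
    unfolding tension_def t_def by (simp add: metric_trace_linear nabla_d_ambient[OF x])
  show "tension g h F x = D G (\<Phi> x) (t x)"
    using components_D_chart[OF x, of "tension g h F x"] * by simp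
qed

lemma D_t_normal:
  assumes x: "x \<in> \<Omega>"
  shows "D t x v \<bullet> \<Phi> x = 0"
  using pullback_nabla_components(2)[OF x smooth_t t_normal(1) tension_ambient(2)]
  by (simp add: t_normal[OF x])

text \<open>The first covariant derivative of the tension field is its ambient derivative: the correction term
  along \<open>\<Phi>\<close> has coefficient \<open>t \<bullet> D\<^sub>v\<Phi> = 0\<close>.\<close>

lemma nabla_tension:
  assumes x: "x \<in> \<Omega>"
  shows "pullback_nabla h F (tension g h F) x v = D G (\<Phi> x) (D t x v)"
    and "D \<psi> (F x) (pullback_nabla h F (tension g h F) x v) = D t x v"
  using pullback_nabla_components(1)[OF x smooth_t t_normal(1) tension_ambient(2), of v]
    pullback_nabla_ambient[OF x smooth_t t_normal(1) tension_ambient(2), of v]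
  by (simp_all add: t_normal[OF x])

lemma second_nabla_tension:
  assumes x: "x \<in> \<Omega>"
  shows "D \<psi> (F x) (second_nabla g h F (tension g h F) x u v)
    = D2 t x u v + (D t x v \<bullet> D \<Phi> x u) *\<^sub>R \<Phi> x - D t x (christoffel g x u v)"
proof -
  have "linear (D \<psi> (F x))" by (rule linear_D[OF chart.differentiable[OF F_in[OF x]]])
  then show ?thesis
    unfolding second_nabla_def
    using pullback_nabla_ambient[where s = "\<lambda>y. D t y v"
        and \<sigma> = "\<lambda>y. pullback_nabla h F (tension g h F) y v" and u = u,
        OF x smooth_on_D[OF smooth_t] D_t_normal nabla_tension(1)]
      nabla_tension(2)[OF x]
    by (simp add: linear_diff)
qed

text \<open>The curvature term of the bitension field is a multiple of \<open>t\<close>, hence normal to \<open>M\<close>: the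
  tangential part of the bitension field only involves the rough Laplacian.\<close>

lemma bitension_tangential:
  assumes x: "x \<in> \<Omega>"
  shows "D \<psi> (F x) (bitension g h F x) \<bullet> D \<Phi> x w
    = metric_trace g x (\<lambda>u v. (D2 t x u v - D t x (christoffel g x u v)) \<bullet> D \<Phi> x w)"
proof -
  have lin: "linear (D \<psi> (F x))" by (rule linear_D[OF chart.differentiable[OF F_in[OF x]]])
  have "D \<psi> (F x) (bitension g h F x)
      = metric_trace g x (\<lambda>u v. D \<psi> (F x) (second_nabla g h F (tension g h F) x u v))
        - metric_trace g x (\<lambda>u v. D \<psi> (F x) (curvature h (F x) (D F x u) (tension g h F x) (D F x v)))"
    unfolding bitension_def rough_laplacian_def minus_minus linear_diff[OF lin] metric_trace_linear[OF lin]
    by (rule refl)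
  moreover have "D \<psi> (F x) (curvature h (F x) (D F x u) (tension g h F x) (D F x v)) \<bullet> D \<Phi> x w = 0" for u v
    unfolding curvature_sphere[OF F_in[OF x]]
    by (simp add: tension_ambient(1)[OF x] D_F(2)[OF x] inner_diff_left t_normal[OF x])
  moreover have "\<Phi> x \<bullet> D \<Phi> x w = 0" using D_map_normal[OF x, of w] by (simp add: inner_commute)
  ultimately show ?thesis
    by (simp add: inner_diff_left inner_add_left metric_trace_inner metric_trace_zero
        second_nabla_tension[OF x])
qed

lemma mean_curvature_ambient:
  assumes x: "x \<in> \<Omega>"
  shows "D \<psi> (F x) (mean_curvature g h F x) = (1 / real DIM('m)) *\<^sub>R t x"
proof -
  have "linear (D \<psi> (F x))" by (rule linear_D[OF chart.differentiable[OF F_in[OF x]]])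
  then show ?thesis
    unfolding mean_curvature_def tension_def[symmetric]
    by (simp add: linear_scale tension_ambient(1)[OF x])
qed

lemma target_metric: "h y u v = D \<psi> y u \<bullet> D \<psi> y v"
  by (simp add: metric_of_def)

lemma norm_mean_curvature:
  assumes x: "x \<in> \<Omega>"
  shows "h (F x) (mean_curvature g h F x) (mean_curvature g h F x) = (t x \<bullet> t x) / (real DIM('m))\<^sup>2"
  unfolding target_metric mean_curvature_ambient[OF x]
  by (simp add: power2_eq_square)

end

section \<open>Pseudo-umbilical biharmonic submanifolds of the sphere\<close>

locale pseudo_umbilical_immersion = sphere_immersion \<Theta> \<psi> W G \<Omega> \<Phi> F
  for \<Theta> :: "'n::euclidean_space set" and \<psi> :: "'n \<Rightarrow> 'a::euclidean_space" and W G
    and \<Omega> :: "'m::euclidean_space set" and \<Phi> :: "'m \<Rightarrow> 'a" and F +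
  fixes \<nu> :: "'m \<Rightarrow> real"
  assumes umbilical: "x \<in> \<Omega> \<Longrightarrow> shape_operator g h F x (mean_curvature g h F x) u = \<nu> x *\<^sub>R u"
begin

text \<open>The multiplier of the metric in \<open>B(u,v) \<bullet> t\<close>.\<close>

definition \<rho> :: "'m \<Rightarrow> real" where "\<rho> x = (t x \<bullet> t x) / real DIM('m)"

lemma second_derivative_t:
  assumes x: "x \<in> \<Omega>"
  shows "D2 \<Phi> x u v \<bullet> t x = B x u v \<bullet> t x"
  unfolding B_def using t_normal[OF x]
  by (simp add: inner_add_right inner_diff_right inner_commute[of _ "t x"])

text \<open>The hypothesis on the shape operator, paired with a tangent vector. The form to which \<open>raise\<close> is
  applied is linear because \<open>t\<close> sees only the second derivative in \<open>B\<close>.\<close>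

lemma B_t_multiplier:
  assumes x: "x \<in> \<Omega>"
  shows "B x u v \<bullet> t x = real DIM('m) * \<nu> x * (D \<Phi> x u \<bullet> D \<Phi> x v)"
proof -
  interpret X: injective_linear "D \<Phi> x" g x by (rule source.injective_linear_D[OF x])
  let ?l = "\<lambda>v. h (F x) (nabla_d g h F x u v) (mean_curvature g h F x)"
  have l: "?l = (\<lambda>v. (D2 \<Phi> x u v \<bullet> t x) / real DIM('m))"
    unfolding target_metric mean_curvature_ambient[OF x] nabla_d_ambient[OF x]
      second_derivative_t[OF x] by simp
  have "linear ?l"
    unfolding l
    by (auto intro!: linearI simp: linear_add[OF linear_D2_right[OF open_\<Omega> smooth_map x]]
        linear_scale[OF linear_D2_right[OF open_\<Omega> smooth_map x]] inner_add_left add_divide_distrib)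
  from X.metric_raise[OF this, of v]
  have "D \<Phi> x (\<nu> x *\<^sub>R u) \<bullet> D \<Phi> x v = (D2 \<Phi> x u v \<bullet> t x) / real DIM('m)"
    using umbilical[OF x, of u] fun_cong[OF l, of v] unfolding shape_operator_def by simp
  then show ?thesis
    by (simp add: linear_scale[OF X.linear] second_derivative_t[OF x] field_simps)
qed

lemma multiplier:
  assumes x: "x \<in> \<Omega>"
  shows "\<nu> x = (t x \<bullet> t x) / (real DIM('m))\<^sup>2" and "\<nu> x = \<rho> x / real DIM('m)"
proof -
  interpret X: injective_linear "D \<Phi> x" g x by (rule source.injective_linear_D[OF x])
  have "t x \<bullet> t x = metric_trace g x (\<lambda>u v. B x u v \<bullet> t x)"
    by (subst t_def) (rule metric_trace_inner)
  also have "\<dots> = real DIM('m) * \<nu> x * real DIM('m)"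
    unfolding B_t_multiplier[OF x] metric_trace_mult X.metric_trace_metric by simp
  finally show "\<nu> x = (t x \<bullet> t x) / (real DIM('m))\<^sup>2" by (simp add: power2_eq_square field_simps)
  then show "\<nu> x = \<rho> x / real DIM('m)" by (simp add: \<rho>_def power2_eq_square)
qed

lemma D2_map_t:
  assumes x: "x \<in> \<Omega>"
  shows "D2 \<Phi> x u v \<bullet> t x = \<rho> x * (D \<Phi> x u \<bullet> D \<Phi> x v)"
  using B_t_multiplier[OF x] multiplier(2)[OF x] by (simp add: second_derivative_t[OF x])

lemma smooth_\<rho>: "smooth_on \<Omega> \<rho>"
proof -
  have "smooth_on \<Omega> (\<lambda>x. (1 / real DIM('m)) *\<^sub>R (t x \<bullet> t x))"
    by (intro smooth_on_scaleR smooth_on_inner smooth_on_const smooth_t open_\<Omega>)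
  then show ?thesis unfolding \<rho>_def by simp
qed

lemma D_t_tangential:
  assumes x: "x \<in> \<Omega>"
  shows "D t x v \<bullet> D \<Phi> x u = - \<rho> x * (D \<Phi> x v \<bullet> D \<Phi> x u)"
proof -
  have "D (\<lambda>y. t y \<bullet> D \<Phi> y u) x v = D (\<lambda>y. 0) x v"
    by (rule D_cong_open[OF open_\<Omega> x t_normal(2)])
  moreover have "D (\<lambda>y. t y \<bullet> D \<Phi> y u) x v = t x \<bullet> D2 \<Phi> x v u + D t x v \<bullet> D \<Phi> x u"
    by (rule D_eq[OF has_derivative_inner[OF smooth_on_has_derivative[OF smooth_t x]
          smooth_on_has_derivative[OF source.smooth_D x]]])
  ultimately show ?thesis by (simp add: inner_commute[of "t x"] D2_map_t[OF x])
qed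

text \<open>Split \<open>D\<^sup>2\<Phi>(u,w)\<close> into \<open>B(u,w)\<close>, its component along \<open>\<Phi>\<close>, and its tangential part; \<open>D\<^sub>vt\<close> is orthogonal
  to \<open>\<Phi>\<close> and has known products with tangent vectors.\<close>

lemma D_t_D2_map:
  assumes x: "x \<in> \<Omega>"
  shows "D t x v \<bullet> D2 \<Phi> x u w = D t x v \<bullet> B x u w - \<rho> x * (D \<Phi> x v \<bullet> D2 \<Phi> x u w)"
proof -
  have "D2 \<Phi> x u w = B x u w - (D \<Phi> x u \<bullet> D \<Phi> x w) *\<^sub>R \<Phi> x + D \<Phi> x (christoffel g x u w)"
    by (simp add: B_def)
  then have "D t x v \<bullet> D2 \<Phi> x u w
      = D t x v \<bullet> (B x u w - (D \<Phi> x u \<bullet> D \<Phi> x w) *\<^sub>R \<Phi> x + D \<Phi> x (christoffel g x u w))"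
    by (rule arg_cong)
  also have "\<dots> = D t x v \<bullet> B x u w + D t x v \<bullet> D \<Phi> x (christoffel g x u w)"
    by (simp add: inner_add_right inner_diff_right D_t_normal[OF x])
  also have "\<dots> = D t x v \<bullet> B x u w - \<rho> x * (D \<Phi> x v \<bullet> D2 \<Phi> x u w)"
    by (simp add: D_t_tangential[OF x] source.christoffel_tangential(1)[OF x]
        inner_commute[of "D \<Phi> x v"])
  finally show ?thesis .
qed

text \<open>Differentiate \<open>D_t_tangential\<close>; the terms with Christoffel symbols cancel, which leaves a
  tensorial expression.\<close>

lemma rough_laplacian_tangential:
  assumes x: "x \<in> \<Omega>"
  shows "(D2 t x u v - D t x (christoffel g x u v)) \<bullet> D \<Phi> x w
    = - (D \<rho> x u * (D \<Phi> x v \<bullet> D \<Phi> x w)) - D t x v \<bullet> B x u w"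
proof -
  have "D (\<lambda>y. D t y v \<bullet> D \<Phi> y w) x u = D (\<lambda>y. - (\<rho> y * (D \<Phi> y v \<bullet> D \<Phi> y w))) x u"
    by (rule D_cong_open[OF open_\<Omega> x]) (simp add: D_t_tangential)
  moreover have "D (\<lambda>y. D t y v \<bullet> D \<Phi> y w) x u = D t x v \<bullet> D2 \<Phi> x u w + D2 t x u v \<bullet> D \<Phi> x w"
    by (rule D_eq[OF has_derivative_inner[OF smooth_on_has_derivative[OF smooth_on_D[OF smooth_t] x]
          smooth_on_has_derivative[OF source.smooth_D x]]])
  moreover have "D (\<lambda>y. - (\<rho> y * (D \<Phi> y v \<bullet> D \<Phi> y w))) x u
      = - (\<rho> x * (D \<Phi> x v \<bullet> D2 \<Phi> x u w + D2 \<Phi> x u v \<bullet> D \<Phi> x w) + D \<rho> x u * (D \<Phi> x v \<bullet> D \<Phi> x w))"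
    by (rule D_eq[OF has_derivative_minus[OF has_derivative_mult[OF smooth_on_has_derivative[OF smooth_\<rho> x]
          has_derivative_inner[OF smooth_on_has_derivative[OF source.smooth_D x]
            smooth_on_has_derivative[OF source.smooth_D x]]]]])
  moreover have "D t x (christoffel g x u v) \<bullet> D \<Phi> x w = - \<rho> x * (D2 \<Phi> x u v \<bullet> D \<Phi> x w)"
    unfolding D_t_tangential[OF x] source.christoffel_tangential(1)[OF x] ..
  ultimately show ?thesis
    unfolding D_t_D2_map[OF x] by (simp add: inner_diff_left algebra_simps)
qed

text \<open>The Codazzi equation paired with \<open>t\<close>. In the ambient space it is the symmetry of third
  derivatives: antisymmetrizing the derivative of \<open>D2_map_t\<close> in \<open>v\<close>, \<open>w\<close> removes \<open>D\<^sup>3\<Phi>\<close>.\<close>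

lemma codazzi:
  assumes x: "x \<in> \<Omega>"
  shows "D t x v \<bullet> B x u w - D t x w \<bullet> B x u v
    = D \<rho> x v * (D \<Phi> x u \<bullet> D \<Phi> x w) - D \<rho> x w * (D \<Phi> x u \<bullet> D \<Phi> x v)"
proof -
  have sym: "D2 \<Phi> x a b = D2 \<Phi> x b a" if "x \<in> \<Omega>" for x a b
    by (rule D2_symmetric[OF open_\<Omega> smooth_map that])
  have third: "D (\<lambda>y. D2 \<Phi> y u w) x v = D (\<lambda>y. D2 \<Phi> y u v) x w" for u v w
  proof -
    have "D (\<lambda>y. D2 \<Phi> y u w) x v = D (\<lambda>y. D2 \<Phi> y w u) x v"
      by (rule D_cong_open[OF open_\<Omega> x]) (rule sym)
    also have "\<dots> = D (\<lambda>y. D2 \<Phi> y v u) x w"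
      by (rule D2_symmetric[OF open_\<Omega> source.smooth_D x])
    also have "\<dots> = D (\<lambda>y. D2 \<Phi> y u v) x w"
      by (rule D_cong_open[OF open_\<Omega> x]) (rule sym)
    finally show ?thesis .
  qed
  have deriv: "D t x v \<bullet> D2 \<Phi> x u w + t x \<bullet> D (\<lambda>y. D2 \<Phi> y u w) x v
      = D \<rho> x v * (D \<Phi> x u \<bullet> D \<Phi> x w) + \<rho> x * (D2 \<Phi> x v u \<bullet> D \<Phi> x w + D \<Phi> x u \<bullet> D2 \<Phi> x v w)" for v w
  proof -
    have "D (\<lambda>y. D2 \<Phi> y u w \<bullet> t y) x v = D (\<lambda>y. \<rho> y * (D \<Phi> y u \<bullet> D \<Phi> y w)) x v"
      by (rule D_cong_open[OF open_\<Omega> x D2_map_t])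
    moreover have "D (\<lambda>y. D2 \<Phi> y u w \<bullet> t y) x v
        = D2 \<Phi> x u w \<bullet> D t x v + D (\<lambda>y. D2 \<Phi> y u w) x v \<bullet> t x"
      by (rule D_eq[OF has_derivative_inner[OF smooth_on_has_derivative[OF smooth_on_D[OF source.smooth_D] x]
          smooth_on_has_derivative[OF smooth_t x]]])
    moreover have "D (\<lambda>y. \<rho> y * (D \<Phi> y u \<bullet> D \<Phi> y w)) x v
        = \<rho> x * (D \<Phi> x u \<bullet> D2 \<Phi> x v w + D2 \<Phi> x v u \<bullet> D \<Phi> x w) + D \<rho> x v * (D \<Phi> x u \<bullet> D \<Phi> x w)"
      by (rule D_eq[OF has_derivative_mult[OF smooth_on_has_derivative[OF smooth_\<rho> x]
          has_derivative_inner[OF smooth_on_has_derivative[OF source.smooth_D x]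
            smooth_on_has_derivative[OF source.smooth_D x]]]])
    ultimately show ?thesis
      by (simp add: inner_commute[of "t x"] inner_commute[of "D t x v"] algebra_simps)
  qed
  have "D t x v \<bullet> D2 \<Phi> x u w - D t x w \<bullet> D2 \<Phi> x u v
      = D \<rho> x v * (D \<Phi> x u \<bullet> D \<Phi> x w) - D \<rho> x w * (D \<Phi> x u \<bullet> D \<Phi> x v)
        + \<rho> x * (D2 \<Phi> x v u \<bullet> D \<Phi> x w - D2 \<Phi> x w u \<bullet> D \<Phi> x v)"
    using deriv[of v w] deriv[of w v] third[where u = u and v = v and w = w] sym[OF x, of v w]
    by (simp add: algebra_simps)
  then show ?thesis
    unfolding D_t_D2_map[OF x] sym[OF x, of u]
    by (simp add: inner_commute[of "D \<Phi> x v"] inner_commute[of "D \<Phi> x w"] algebra_simps)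
qed

text \<open>Both identities are traced over \<open>u\<close>, \<open>v\<close>; they evaluate the same trace \<open>S\<close> of \<open>D\<^sub>vt \<bullet> B(u,w)\<close> as
  \<open>- D\<^sub>w\<rho>\<close> and as \<open>t \<bullet> D\<^sub>wt + (1 - m) D\<^sub>w\<rho>\<close>, where \<open>t \<bullet> D\<^sub>wt = (m/2) D\<^sub>w\<rho>\<close>.\<close>

lemma D_multiplier_eq_0:
  assumes x: "x \<in> \<Omega>" and biharmonic: "bitension g h F x = 0" and dim: "DIM('m) \<noteq> 4"
  shows "D \<rho> x w = 0"
proof -
  interpret X: injective_linear "D \<Phi> x" g x by (rule source.injective_linear_D[OF x])
  have lin_\<rho>: "linear (D \<rho> x)" by (rule linear_D[OF smooth_on_differentiable[OF smooth_\<rho> x]])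
  let ?S = "metric_trace g x (\<lambda>u v. D t x v \<bullet> B x u w)"
  have "D \<psi> (F x) (bitension g h F x) \<bullet> D \<Phi> x w = 0"
    by (simp add: biharmonic linear_0[OF linear_D[OF chart.differentiable[OF F_in[OF x]]]])
  then have "metric_trace g x (\<lambda>u v. - ((D \<Phi> x v \<bullet> D \<Phi> x w) *\<^sub>R D \<rho> x u) - D t x v \<bullet> B x u w) = 0"
    unfolding bitension_tangential[OF x] rough_laplacian_tangential[OF x] by (simp add: mult.commute)
  then have laplacian: "- D \<rho> x w - ?S = 0"
    unfolding metric_trace_diff metric_trace_minus X.metric_trace_contract[OF lin_\<rho>] .
  have "metric_trace g x (\<lambda>u v. D t x v \<bullet> B x u w - D t x w \<bullet> B x u v)
      = metric_trace g x (\<lambda>u v. (D \<Phi> x u \<bullet> D \<Phi> x w) *\<^sub>R D \<rho> x v - D \<rho> x w * (D \<Phi> x u \<bullet> D \<Phi> x v))"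
    unfolding codazzi[OF x] by (simp add: mult.commute)
  then have "?S - t x \<bullet> D t x w = D \<rho> x w - D \<rho> x w * real DIM('m)"
    unfolding metric_trace_diff X.metric_trace_contract'[OF lin_\<rho>] metric_trace_mult X.metric_trace_metric
    by (simp add: t_def[of x] metric_trace_inner inner_commute[of "D t x w"])
  moreover have "D \<rho> x w = 2 * (t x \<bullet> D t x w) / real DIM('m)"
  proof -
    have "\<rho> = (\<lambda>x. (1 / real DIM('m)) * (t x \<bullet> t x))" by (simp add: \<rho>_def fun_eq_iff)
    then have "(\<rho> has_derivative (\<lambda>w. (1 / real DIM('m)) * (t x \<bullet> D t x w + D t x w \<bullet> t x))) (at x)"
      by (simp only:) (rule has_derivative_mult_right[OF has_derivative_inner[OF smooth_on_has_derivative[OF smooth_t x]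
          smooth_on_has_derivative[OF smooth_t x]]])
    from D_eq[OF this] show ?thesis by (simp add: inner_commute)
  qed
  then have "t x \<bullet> D t x w = real DIM('m) / 2 * D \<rho> x w" by (simp add: field_simps)
  ultimately have "2 * D \<rho> x w - real DIM('m) / 2 * D \<rho> x w = 0"
    using laplacian by argo
  then have "(2 - real DIM('m) / 2) * D \<rho> x w = 0" by (simp only: left_diff_distrib)
  moreover have "2 - real DIM('m) / 2 \<noteq> 0" using dim by simp
  ultimately show ?thesis by simp
qed

lemma multiplier_has_derivative_0:
  assumes x: "x \<in> \<Omega>" and biharmonic: "bitension g h F x = 0" and dim: "DIM('m) \<noteq> 4"
  shows "(\<nu> has_derivative (\<lambda>_. 0)) (at x)"
proof -
  have "((\<lambda>y. (1 / real DIM('m)) * \<rho> y) has_derivative (\<lambda>w. (1 / real DIM('m)) * D \<rho> x w)) (at x)"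
    by (rule has_derivative_mult_right[OF smooth_on_has_derivative[OF smooth_\<rho> x]])
  then have "((\<lambda>y. (1 / real DIM('m)) * \<rho> y) has_derivative (\<lambda>_. 0)) (at x)"
    by (simp add: D_multiplier_eq_0[OF assms])
  then show ?thesis
    by (rule has_derivative_transform_within_open[OF _ open_\<Omega> x]) (simp add: multiplier(2))
qed

end

section \<open>Stereographic charts\<close>

text \<open>Stereographic projection from \<open>- q\<close>, composed with an isometry of the hyperplane \<open>q\<^sup>\<bottom>\<close> onto
  the model space. It is given by a rational formula off the hyperplane \<open>1 + p \<bullet> q = 0\<close>, which provides
  the smooth extension, and its inverse is rational as well.\<close>

lemma standard_charts_cover_sphere:
  fixes q :: "'a::euclidean_space"
  assumes dim: "DIM('a) = DIM('n::euclidean_space) + 1" and q: "q \<in> sphere 0 1"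
  shows "\<exists>V d. (V, d) \<in> (standard_charts (sphere 0 1) :: ('a, 'n) chart set) \<and> q \<in> V"
proof -
  have qq: "q \<bullet> q = 1" using q by (simp add: dot_square_norm)
  then have "q \<noteq> 0" by auto
  let ?H = "{z. q \<bullet> z = 0}"
  have "dim ?H = dim (UNIV :: 'n set)" using \<open>q \<noteq> 0\<close> by (simp add: dim_hyperplane dim)
  then obtain f g where f: "linear f" and g: "linear g" and "f ` ?H = (UNIV :: 'n set)"
    and g_range: "g ` (UNIV :: 'n set) = ?H" and "\<And>z. z \<in> ?H \<Longrightarrow> norm (f z) = norm z"
    and norm_g: "\<And>y. y \<in> UNIV \<Longrightarrow> norm (g y) = norm y"
    and gf: "\<And>z. z \<in> ?H \<Longrightarrow> g (f z) = z" and fg: "\<And>y. y \<in> UNIV \<Longrightarrow> f (g y) = y"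
    by (rule isometries_subspaces[OF subspace_hyperplane subspace_UNIV]) (rule that; assumption)
  note norm_g = norm_g[OF UNIV_I] and fg = fg[OF UNIV_I]
  have gq: "g y \<bullet> q = 0" "q \<bullet> g y = 0" for y using g_range by (auto simp: inner_commute)
  have gg: "g y \<bullet> g y = y \<bullet> y" for y using norm_g[of y] by (simp add: dot_square_norm)
  define W where "W = {p::'a. 1 + p \<bullet> q \<noteq> 0}"
  define V where "V = sphere 0 1 - {- q}"
  define d where "d p = inverse (1 + p \<bullet> q) *\<^sub>R f (p - (p \<bullet> q) *\<^sub>R q)" for p
  define \<psi> where "\<psi> y = inverse (1 + y \<bullet> y) *\<^sub>R (2 *\<^sub>R g y + (1 - y \<bullet> y) *\<^sub>R q)" for y :: 'n
  have pos: "1 + y \<bullet> y > 0" for y :: 'n using inner_ge_zero[of y] by linarith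
  have openW: "open W"
    unfolding W_def by (intro open_Collect_neq continuous_intros)
  have VW: "V \<subseteq> W"
  proof
    fix p assume p: "p \<in> V"
    have "1 + p \<bullet> q \<noteq> 0"
    proof
      assume "1 + p \<bullet> q = 0"
      moreover have "p \<bullet> p = 1" using p by (simp add: V_def dot_square_norm)
      ultimately have "(p + q) \<bullet> (p + q) = 0"
        using qq by (simp add: inner_add_left inner_add_right inner_commute)
      then have "p = - q" by (simp add: eq_neg_iff_add_eq_0)
      with p show False by (simp add: V_def)
    qed
    then show "p \<in> W" by (simp add: W_def)
  qed
  have \<psi>q: "\<psi> y \<bullet> q = inverse (1 + y \<bullet> y) * (1 - y \<bullet> y)" for y
    by (simp add: \<psi>_def inner_add_left gq qq)
  have \<psi>q1: "1 + \<psi> y \<bullet> q = 2 * inverse (1 + y \<bullet> y)" for y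
    unfolding \<psi>q using pos[of y] by (simp add: field_simps)
  have \<psi>V: "\<psi> y \<in> V" for y
  proof -
    have "\<psi> y \<bullet> \<psi> y = (inverse (1 + y \<bullet> y))\<^sup>2 * (4 * (y \<bullet> y) + (1 - y \<bullet> y)\<^sup>2)"
      by (simp add: \<psi>_def inner_add_left inner_add_right gq qq gg power2_eq_square algebra_simps)
    also have "4 * (y \<bullet> y) + (1 - y \<bullet> y)\<^sup>2 = (1 + y \<bullet> y)\<^sup>2"
      by (simp add: power2_eq_square algebra_simps)
    finally have "\<psi> y \<bullet> \<psi> y = 1"
      using pos[of y] by (simp add: power_mult_distrib[symmetric])
    moreover have "\<psi> y \<noteq> - q"
    proof
      assume "\<psi> y = - q"
      then have "1 + \<psi> y \<bullet> q = 0" by (simp add: qq)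
      then show False using pos[of y] by (simp add: \<psi>q1)
    qed
    ultimately show ?thesis by (simp add: V_def norm_eq_sqrt_inner)
  qed
  have d\<psi>: "d (\<psi> y) = y" for y
  proof -
    have "\<psi> y - (\<psi> y \<bullet> q) *\<^sub>R q = (2 * inverse (1 + y \<bullet> y)) *\<^sub>R g y"
      unfolding \<psi>q by (simp add: \<psi>_def algebra_simps)
    then have "d (\<psi> y) = inverse (2 * inverse (1 + y \<bullet> y)) *\<^sub>R (2 * inverse (1 + y \<bullet> y)) *\<^sub>R y"
      unfolding d_def \<psi>q1 by (simp only: linear_scale[OF f] fg)
    then show ?thesis using pos[of y] by simp
  qed
  have \<psi>d: "\<psi> (d p) = p" if p: "p \<in> V" for p
  proof -
    define s where "s = p \<bullet> q"
    define z where "z = p - s *\<^sub>R q"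
    have s: "1 + s \<noteq> 0" using p VW by (auto simp: W_def s_def)
    have pp: "p \<bullet> p = 1" using p by (simp add: V_def dot_square_norm)
    have qz: "q \<bullet> z = 0" by (simp add: z_def s_def inner_diff_right qq inner_commute)
    have zz: "z \<bullet> z = (1 - s) * (1 + s)"
      unfolding z_def
      by (simp add: inner_diff_right inner_diff_left pp qq inner_commute[of q p] s_def[symmetric] algebra_simps)
    have gd: "g (d p) = inverse (1 + s) *\<^sub>R z"
      unfolding d_def s_def[symmetric] z_def[symmetric]
      using qz by (simp add: linear_scale[OF g] gf)
    have dd: "d p \<bullet> d p = (1 - s) / (1 + s)"
    proof -
      have "d p \<bullet> d p = inverse (1 + s) * (inverse (1 + s) * ((1 - s) * (1 + s)))"
        using gg[of "d p"] unfolding gd by (simp add: zz)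
      then show ?thesis using s by (simp add: divide_simps)
    qed
    have i: "inverse (1 + d p \<bullet> d p) = (1 + s) / 2" "1 - d p \<bullet> d p = 2 * s / (1 + s)"
      unfolding dd using s by (simp_all add: field_simps)
    have "\<psi> (d p) = ((1 + s) / 2) *\<^sub>R (2 *\<^sub>R inverse (1 + s) *\<^sub>R z + (2 * s / (1 + s)) *\<^sub>R q)"
      unfolding \<psi>_def i gd ..
    also have "\<dots> = z + s *\<^sub>R q" using s by (simp add: scaleR_add_right)
    also have "\<dots> = p" by (simp add: z_def)
    finally show ?thesis .
  qed
  have inj: "inj_on d V" by (rule inj_on_inverseI[where g = \<psi>]) (rule \<psi>d)
  have image: "d ` V = UNIV" using d\<psi> \<psi>V by (auto intro!: image_eqI[where x = "\<psi> _"])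
  have inv: "inv_into V d y = \<psi> y" for y
    using inv_into_f_f[OF inj \<psi>V[of y]] by (simp add: d\<psi>)
  have bl: "bounded_linear f" "bounded_linear g"
    using f g by (simp_all add: linear_conv_bounded_linear)
  have smooth_d: "smooth_on W d"
    unfolding d_def
    by (intro smooth_on_scaleR smooth_on_inverse smooth_on_bounded_linear[OF _ bl(1)] smooth_on_add
        smooth_on_diff smooth_on_inner smooth_on_const smooth_on_ident openW) (simp add: W_def)
  have smooth_\<psi>: "smooth_on UNIV \<psi>"
    unfolding \<psi>_def
    by (intro smooth_on_scaleR smooth_on_inverse smooth_on_bounded_linear[OF _ bl(2)] smooth_on_add
        smooth_on_diff smooth_on_inner smooth_on_const smooth_on_ident open_UNIV)
      (use pos in \<open>auto simp: less_le\<close>)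
  have "openin (top_of_set (sphere 0 1)) V"
    unfolding V_def by (rule openin_delete) simp
  moreover have "smooth_on (d ` V) (inv_into V d)" unfolding image inv using smooth_\<psi> by simp
  moreover have "open (d ` V)" unfolding image by simp
  ultimately have "(V, d) \<in> standard_charts (sphere 0 1)"
    unfolding standard_charts_def using inj openW VW smooth_d by blast
  moreover have "q \<in> V" using q \<open>q \<noteq> 0\<close> by (simp add: V_def eq_neg_iff_add_eq_0 flip: scaleR_2)
  ultimately show ?thesis by blast
qed

section \<open>From charts to the manifold\<close>

lemma induced_metric_chart:
  "induced_metric \<phi> (U, c) = metric_of (\<phi> \<circ> inv_into U c)"
  "induced_metric (\<lambda>q. q) (V, d) = metric_of (inv_into V d)"
  by (simp_all add: induced_metric_def metric_of_def comp_def)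

text \<open>The coordinate expressions on a common domain of two charts satisfy the assumptions under which
  the local computation was made.\<close>

lemma pseudo_umbilical_immersion_in_charts:
  fixes A :: "('p, 'm::euclidean_space) chart set" and \<phi> :: "'p \<Rightarrow> 'a::euclidean_space"
    and V :: "'a set" and d :: "'a \<Rightarrow> 'n::euclidean_space"
  assumes dim: "DIM('a) = DIM('n) + 1"
    and immersed: "immersed_submanifold X A \<phi> (sphere 0 1)"
    and c: "(U, c) \<in> A" and d: "(V, d) \<in> standard_charts (sphere 0 1)"
    and umbilical: "\<And>p u. p \<in> U \<inter> \<phi> -` V \<Longrightarrow>
      shape_operator (induced_metric \<phi> (U, c)) (induced_metric (\<lambda>q. q) (V, d))
        (d \<circ> \<phi> \<circ> inv_into U c) (c p)
        (mean_curvature (induced_metric \<phi> (U, c)) (induced_metric (\<lambda>q. q) (V, d))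
          (d \<circ> \<phi> \<circ> inv_into U c) (c p)) u = \<mu> p *\<^sub>R u"
  shows "\<exists>W G. pseudo_umbilical_immersion (d ` V) (inv_into V d) W G (c ` (U \<inter> \<phi> -` V))
    (\<phi> \<circ> inv_into U c) (d \<circ> \<phi> \<circ> inv_into U c) (\<mu> \<circ> inv_into U c)"
proof -
  have U: "openin X U" "open (c ` U)" "homeomorphic_map (subtopology X U) (top_of_set (c ` U)) c"
    and sphere: "\<phi> ` topspace X \<subseteq> sphere 0 1"
    and smooth: "smooth_on (c ` U) (\<phi> \<circ> inv_into U c)"
    and inj_D: "\<And>x. x \<in> c ` U \<Longrightarrow> inj (D (\<phi> \<circ> inv_into U c) x)"
    using immersed c unfolding immersed_submanifold_def connected_manifold_def by auto
  have UX: "U \<subseteq> topspace X" by (rule openin_subset[OF U(1)])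
  have inj_c: "inj_on c U"
    using homeomorphic_imp_injective_map[OF U(3)] UX by (simp add: Int_absorb1)
  obtain W G where V: "openin (top_of_set (sphere 0 1)) V" "open (d ` V)" and inj_d: "inj_on d V"
    and smooth_inv: "smooth_on (d ` V) (inv_into V d)"
    and W: "open W" "V \<subseteq> W" "smooth_on W G" "\<And>q. q \<in> V \<Longrightarrow> G q = d q"
    using d unfolding standard_charts_def by auto
  obtain O' where O': "open O'" "V = sphere 0 1 \<inter> O'" using V(1) by (auto simp: openin_open)
  have eq: "c ` (U \<inter> \<phi> -` V) = c ` U \<inter> (\<phi> \<circ> inv_into U c) -` O'"
    using sphere UX O'(2) inj_c by (auto simp: image_subset_iff)
  have inv_V: "inv_into V d y \<in> V" "d (inv_into V d y) = y" if "y \<in> d ` V" for y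
    using that by (auto intro: inv_into_into f_inv_into_f)
  have in_V: "(\<phi> \<circ> inv_into U c) x \<in> V" "inv_into U c x \<in> U \<inter> \<phi> -` V" "c (inv_into U c x) = x"
      "x \<in> c ` U"
    if "x \<in> c ` (U \<inter> \<phi> -` V)" for x
    using that inj_c by auto
  have "pseudo_umbilical_immersion (d ` V) (inv_into V d) W G (c ` (U \<inter> \<phi> -` V))
    (\<phi> \<circ> inv_into U c) (d \<circ> \<phi> \<circ> inv_into U c) (\<mu> \<circ> inv_into U c)"
  proof (unfold_locales)
    show "DIM('a) = DIM('n) + 1" by fact
    show "open (d ` V)" "smooth_on (d ` V) (inv_into V d)" "open W" "smooth_on W G" by fact+
    fix y assume y: "y \<in> d ` V"
    show "inv_into V d y \<in> W" using inv_V[OF y] W(2) by blast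
    show "G (inv_into V d y) = y" using inv_V[OF y] W(4) by simp
    show "inv_into V d y \<bullet> inv_into V d y = 1"
      using inv_V(1)[OF y] O'(2) by (simp add: dot_square_norm)
  next
    show "open (c ` (U \<inter> \<phi> -` V))"
      unfolding eq by (rule continuous_open_preimage[OF smooth_on_continuous_on[OF smooth] U(2) O'(1)])
    show "smooth_on (c ` (U \<inter> \<phi> -` V)) (\<phi> \<circ> inv_into U c)"
      by (rule smooth_on_subset[OF smooth]) auto
  next
    fix x assume x: "x \<in> c ` (U \<inter> \<phi> -` V)"
    show "(d \<circ> \<phi> \<circ> inv_into U c) x \<in> d ` V" using in_V(1)[OF x] by simp
    show "inv_into V d ((d \<circ> \<phi> \<circ> inv_into U c) x) = (\<phi> \<circ> inv_into U c) x"
      using inv_into_f_f[OF inj_d in_V(1)[OF x]] by simp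
    show "inj (D (\<phi> \<circ> inv_into U c) x)" by (rule inj_D[OF in_V(4)[OF x]])
    show "shape_operator (metric_of (\<phi> \<circ> inv_into U c)) (metric_of (inv_into V d))
        (d \<circ> \<phi> \<circ> inv_into U c) x
        (mean_curvature (metric_of (\<phi> \<circ> inv_into U c)) (metric_of (inv_into V d))
          (d \<circ> \<phi> \<circ> inv_into U c) x) u = (\<mu> \<circ> inv_into U c) x *\<^sub>R u" for u
      using umbilical[OF in_V(2)[OF x], of u]
      unfolding induced_metric_chart(1)[of \<phi>] induced_metric_chart(2) in_V(3)[OF x] by simp
  qed
  then show ?thesis by blast
qed

lemma locally_constant_on_connected_space:
  assumes X: "connected_space X"
    and loc: "\<And>p. p \<in> topspace X \<Longrightarrow> \<exists>N. openin X N \<and> p \<in> N \<and> (\<forall>q\<in>N. f q = f p)"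
  shows "\<exists>k. \<forall>p\<in>topspace X. f p = k"
proof (cases "topspace X = {}")
  case False
  then have "\<exists>p. p \<in> topspace X" by (simp only: ex_in_conv not_False_eq_True)
  then obtain p0 where p0: "p0 \<in> topspace X" ..
  have op: "openin X {p \<in> topspace X. P (f p)}" for P
  proof (rule iffD2[OF openin_subopen], intro ballI)
    fix p assume "p \<in> {p \<in> topspace X. P (f p)}"
    then have p: "p \<in> topspace X" "P (f p)" by simp_all
    obtain N where N: "openin X N" "p \<in> N" "\<And>q. q \<in> N \<Longrightarrow> f q = f p" using loc[OF p(1)] by blast
    have "N \<subseteq> {p \<in> topspace X. P (f p)}"
    proof
      fix q assume q: "q \<in> N"
      have "P (f q)" unfolding N(3)[OF q] by (rule p(2))
      then show "q \<in> {p \<in> topspace X. P (f p)}" using q openin_subset[OF N(1)] by blast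
    qed
    with N(1,2) show "\<exists>T. openin X T \<and> p \<in> T \<and> T \<subseteq> {p \<in> topspace X. P (f p)}" by blast
  qed
  have "topspace X - {p \<in> topspace X. f p = f p0} = {p \<in> topspace X. f p \<noteq> f p0}" by blast
  then have "closedin X {p \<in> topspace X. f p = f p0}"
    using op[of "\<lambda>r. r \<noteq> f p0"] by (simp add: closedin_def)
  moreover have "openin X {p \<in> topspace X. f p = f p0}" by (rule op)
  ultimately have "{p \<in> topspace X. f p = f p0} = topspace X"
    using X p0 unfolding connected_space_clopen_in by blast
  then show ?thesis by blast
qed auto

theorem theorem5p1:
  fixes X :: "'p topology"
    and A :: "('p, 'm::euclidean_space) chart set"
    and \<phi> :: "'p \<Rightarrow> 'a::euclidean_space"
    and S :: "('a, 'n::euclidean_space) chart set"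
  assumes "DIM('a) = DIM('n) + 1"
    and "S = standard_charts (sphere 0 1)"
    and "immersed_submanifold X A \<phi> (sphere 0 1)"
    and "pseudo_umbilical A (induced_metric \<phi>) S (induced_metric (\<lambda>q. q)) \<phi>"
    and "DIM('m) \<noteq> 4"
    and "biharmonic A (induced_metric \<phi>) S (induced_metric (\<lambda>q. q)) \<phi>"
  shows "constant_mean_curvature A (induced_metric \<phi>) S (induced_metric (\<lambda>q. q)) \<phi>"
proof -
  obtain \<mu> where \<mu>: "\<And>U c V d p u. (U, c) \<in> A \<Longrightarrow> (V, d) \<in> S \<Longrightarrow> p \<in> U \<inter> \<phi> -` V \<Longrightarrow>
      shape_operator (induced_metric \<phi> (U, c)) (induced_metric (\<lambda>q. q) (V, d))
        (d \<circ> \<phi> \<circ> inv_into U c) (c p)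
        (mean_curvature (induced_metric \<phi> (U, c)) (induced_metric (\<lambda>q. q) (V, d))
          (d \<circ> \<phi> \<circ> inv_into U c) (c p)) u = \<mu> p *\<^sub>R u"
    using assms(4) unfolding pseudo_umbilical_def Let_def by blast
  have connected: "connected_space X" and cover: "(\<Union>(U, c)\<in>A. U) = topspace X"
    and charts: "\<And>U c. (U, c) \<in> A \<Longrightarrow> openin X U \<and> open (c ` U) \<and>
        homeomorphic_map (subtopology X U) (top_of_set (c ` U)) c"
    and sphere: "\<phi> ` topspace X \<subseteq> sphere 0 1"
    using assms(3) unfolding immersed_submanifold_def connected_manifold_def by auto
  have inj_c: "inj_on c U" if "(U, c) \<in> A" for U c
    using homeomorphic_imp_injective_map[of "subtopology X U" _ c] charts[OF that]
      openin_subset[of X U] by (auto simp: Int_absorb1)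
  (* In each pair of charts the trace of the umbilicity condition identifies the norm of H. *)
  have norm: "sqrt (induced_metric (\<lambda>q. q) (V, d) ((d \<circ> \<phi> \<circ> inv_into U c) (c p)) H H) = sqrt (\<mu> p)"
    if at: "(U, c) \<in> A" "(V, d) \<in> S" "p \<in> U \<inter> \<phi> -` V"
      "H = mean_curvature (induced_metric \<phi> (U, c)) (induced_metric (\<lambda>q. q) (V, d))
        (d \<circ> \<phi> \<circ> inv_into U c) (c p)"
    for U c V d p H
  proof -
    obtain W G where "pseudo_umbilical_immersion (d ` V) (inv_into V d) W G (c ` (U \<inter> \<phi> -` V))
        (\<phi> \<circ> inv_into U c) (d \<circ> \<phi> \<circ> inv_into U c) (\<mu> \<circ> inv_into U c)"
      using pseudo_umbilical_immersion_in_charts[OF assms(1,3) at(1), of V d \<mu>] \<mu> at(1,2)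
      unfolding assms(2) by blast
    then interpret pseudo_umbilical_immersion "d ` V" "inv_into V d" W G "c ` (U \<inter> \<phi> -` V)"
      "\<phi> \<circ> inv_into U c" "d \<circ> \<phi> \<circ> inv_into U c" "\<mu> \<circ> inv_into U c" .
    have cp: "c p \<in> c ` (U \<inter> \<phi> -` V)" using at(3) by blast
    have "inv_into U c (c p) = p" using inv_into_f_f[OF inj_c[OF at(1)]] at(3) by simp
    then show ?thesis
      using norm_mean_curvature[OF cp] multiplier(1)[OF cp]
      unfolding at(4) induced_metric_chart(1)[of \<phi>] induced_metric_chart(2) by simp
  qed
  (* The derivative of the multiplier vanishes on a coordinate ball around p. *)
  have loc: "\<exists>N. openin X N \<and> p \<in> N \<and> (\<forall>q\<in>N. \<mu> q = \<mu> p)" if p: "p \<in> topspace X" for p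
  proof -
    obtain U c where c: "(U, c) \<in> A" "p \<in> U" using p cover by blast
    have "\<phi> p \<in> sphere 0 1" using p sphere by blast
    then obtain V and d :: "'a \<Rightarrow> 'n" where d: "(V, d) \<in> S" "\<phi> p \<in> V"
      unfolding assms(2) using standard_charts_cover_sphere[OF assms(1)] by blast
    obtain W G where "pseudo_umbilical_immersion (d ` V) (inv_into V d) W G (c ` (U \<inter> \<phi> -` V))
        (\<phi> \<circ> inv_into U c) (d \<circ> \<phi> \<circ> inv_into U c) (\<mu> \<circ> inv_into U c)"
      using pseudo_umbilical_immersion_in_charts[OF assms(1,3) c(1), of V d \<mu>] \<mu> c(1) d(1)
      unfolding assms(2) by blast
    then interpret pseudo_umbilical_immersion "d ` V" "inv_into V d" W G "c ` (U \<inter> \<phi> -` V)"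
      "\<phi> \<circ> inv_into U c" "d \<circ> \<phi> \<circ> inv_into U c" "\<mu> \<circ> inv_into U c" .
    have zero: "((\<mu> \<circ> inv_into U c) has_derivative (\<lambda>_. 0)) (at x)" if x: "x \<in> c ` (U \<inter> \<phi> -` V)" for x
    proof (rule multiplier_has_derivative_0[OF x _ assms(5)])
      obtain q where "q \<in> U \<inter> \<phi> -` V" "x = c q" using x by blast
      then show "bitension g h (d \<circ> \<phi> \<circ> inv_into U c) x = 0"
        using assms(6) c(1) d(1)
        unfolding biharmonic_def induced_metric_chart(1)[of \<phi>, symmetric]
          induced_metric_chart(2)[symmetric]
        by blast
    qed
    have "c p \<in> c ` (U \<inter> \<phi> -` V)" using c d by blast
    then obtain r where r: "r > 0" "ball (c p) r \<subseteq> c ` (U \<inter> \<phi> -` V)"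
      using open_\<Omega> openE by blast
    obtain k where k: "\<And>x. x \<in> ball (c p) r \<Longrightarrow> (\<mu> \<circ> inv_into U c) x = k"
      using has_derivative_zero_constant[OF convex_ball, of "c p" r "\<mu> \<circ> inv_into U c"] zero r(2)
      by (meson has_derivative_at_withinI subsetD)
    let ?N = "{q \<in> U. c q \<in> ball (c p) r}"
    have \<mu>_k: "\<mu> q = k" if "q \<in> ?N" for q
      using k[of "c q"] that inv_into_f_f[OF inj_c[OF c(1)], of q] by simp
    have "openin (subtopology X U) ?N"
    proof -
      have "openin (top_of_set (c ` U)) (c ` U \<inter> ball (c p) r)" by (simp add: openin_open_Int)
      from openin_continuous_map_preimage[OF homeomorphic_imp_continuous_map this]
      have "openin (subtopology X U) {q \<in> topspace (subtopology X U). c q \<in> c ` U \<inter> ball (c p) r}"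
        using charts[OF c(1)] by blast
      moreover have "topspace (subtopology X U) = U"
        using openin_subset[of X U] charts[OF c(1)] by (simp add: Int_absorb1)
      moreover have "{q \<in> U. c q \<in> c ` U \<inter> ball (c p) r} = ?N" by blast
      ultimately show ?thesis by metis
    qed
    then have "openin X ?N" using charts[OF c(1)] openin_open_subtopology by blast
    moreover have "p \<in> ?N" using c(2) r(1) by simp
    ultimately show ?thesis using \<mu>_k by (intro exI[of _ ?N]) auto
  qed
  obtain k where k: "\<And>p. p \<in> topspace X \<Longrightarrow> \<mu> p = k"
    using locally_constant_on_connected_space[OF connected loc] by blast
  have "sqrt (induced_metric (\<lambda>q. q) (V, d) ((d \<circ> \<phi> \<circ> inv_into U c) (c p)) H H) = sqrt k"
    if "(U, c) \<in> A" "(V, d) \<in> S" "p \<in> U \<inter> \<phi> -` V"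
      "H = mean_curvature (induced_metric \<phi> (U, c)) (induced_metric (\<lambda>q. q) (V, d))
        (d \<circ> \<phi> \<circ> inv_into U c) (c p)"
    for U c V d p H
  proof -
    have "p \<in> topspace X" using that(1,3) cover by blast
    then show ?thesis using norm[OF that] k by simp
  qed
  then show ?thesis unfolding constant_mean_curvature_def Let_def by blast
qed

end
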